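(* Let $p$ be an odd prime and let $G$ be a finite nonabelian nilpotent group of class $2$ and exponent $p$, minimally generated by $x_1,\ldots,x_n$, with $n>2$. If $$\dim_{\mathbb{F}_p}\bigl([G,G]\bigr)\ \ge\ \binom{n}{2}-2,$$ then $G$ is capable.
   Context: A group $G$ is capable if there is a group $H$ with $G\cong H/Z(H)$. "Minimally generated by $x_1,\ldots,x_n$" means these elements generate $G$ and $G$ cannot be generated by fewer than $n$ elements. Since $G$ has class $2$ and exponent $p$, $[G,G]$ is an elementary abelian $p$-group, regarded as an $\mathbb{F}_p$-vector space. *)

theory Defs
  imports
    "HOL-Algebra.Generated_Groups"
    "HOL-Number_Theory.Residues"
    "Jordan_Normal_Form.Missing_VectorSpace"
begin

section \<open>Capable groups\<close>

definition group_center :: "('a, 'm) monoid_scheme \<Rightarrow> 'a set" where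
  "group_center G = {z \<in> carrier G. \<forall>g \<in> carrier G. z \<otimes>\<^bsub>G\<^esub> g = g \<otimes>\<^bsub>G\<^esub> z}"

text \<open>HOL cannot quantify over the type carrying the witness \<open>H\<close>.  The type of words over
  \<open>'a \<times> bool\<close> (letters and their formal inverses) is large enough for this to be no restriction:
  lemma \<open>capableI\<close> below shows that a witness over any type whatsoever yields one over this type.\<close>

definition capable :: "('a, 'm) monoid_scheme \<Rightarrow> bool" where
  "capable G \<longleftrightarrow>
     (\<exists>H :: ('a \<times> bool) list monoid. group H \<and> G \<cong> H Mod group_center H)"

lemma (in group) group_center_subgroup: "subgroup (group_center G) G"
proof
  show "group_center G \<subseteq> carrier G" by (auto simp: group_center_def)
next
  fix x y assume "x \<in> group_center G" "y \<in> group_center G"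
  then have xy: "x \<in> carrier G" "y \<in> carrier G"
      and xx: "\<And>g. g \<in> carrier G \<Longrightarrow> x \<otimes> g = g \<otimes> x"
      and yy: "\<And>g. g \<in> carrier G \<Longrightarrow> y \<otimes> g = g \<otimes> y"
    by (auto simp: group_center_def)
  have "x \<otimes> y \<otimes> g = g \<otimes> (x \<otimes> y)" if g: "g \<in> carrier G" for g
  proof -
    have "x \<otimes> y \<otimes> g = x \<otimes> (g \<otimes> y)" using xy g yy[OF g] by (simp add: m_assoc)
    also have "\<dots> = (g \<otimes> x) \<otimes> y" using xy g xx[OF g] by (simp only: m_assoc[symmetric])
    finally show ?thesis using xy g by (simp add: m_assoc)
  qed
  then show "x \<otimes> y \<in> group_center G" using xy by (simp add: group_center_def)
next
  show "\<one> \<in> group_center G" by (auto simp: group_center_def)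
next
  fix x assume x: "x \<in> group_center G"
  then have xc: "x \<in> carrier G" and xx: "\<And>g. g \<in> carrier G \<Longrightarrow> x \<otimes> g = g \<otimes> x"
    by (auto simp: group_center_def)
  have "inv x \<otimes> g = g \<otimes> inv x" if g: "g \<in> carrier G" for g
  proof -
    have "inv x \<otimes> g = inv x \<otimes> (g \<otimes> x) \<otimes> inv x"
      using xc g by (simp add: m_assoc)
    also have "\<dots> = inv x \<otimes> (x \<otimes> g) \<otimes> inv x" using xx[OF g] by simp
    also have "\<dots> = g \<otimes> inv x" using xc g by (simp add: m_assoc[symmetric])
    finally show ?thesis .
  qed
  then show "inv x \<in> group_center G" using xc by (auto simp: group_center_def)
qed

lemma (in group) group_center_normal: "group_center G \<lhd> G"
proof (rule normal_invI[OF group_center_subgroup])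
  fix x h assume x: "x \<in> carrier G" and h: "h \<in> group_center G"
  then have "h \<in> carrier G" and "x \<otimes> h = h \<otimes> x" by (auto simp: group_center_def)
  then have "x \<otimes> h \<otimes> inv x = h" using x by (simp only: m_assoc inv_closed r_inv r_one)
  then show "x \<otimes> h \<otimes> inv x \<in> group_center G" using h by simp
qed

definition word_eval :: "('h, 'n) monoid_scheme \<Rightarrow> ('a \<Rightarrow> 'h) \<Rightarrow> ('a \<times> bool) list \<Rightarrow> 'h" where
  "word_eval H r w =
     foldr (\<lambda>(a, b) h. (if b then r a else inv\<^bsub>H\<^esub> r a) \<otimes>\<^bsub>H\<^esub> h) w \<one>\<^bsub>H\<^esub>"

lemma (in group) word_eval_append:
  assumes "\<And>a. r a \<in> carrier G"
  shows "word_eval G r u \<in> carrier G"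
    and "word_eval G r (u @ v) = word_eval G r u \<otimes> word_eval G r v"
proof -
  show c: "word_eval G r u \<in> carrier G" for u
    using assms by (induction u) (auto simp: word_eval_def)
  show "word_eval G r (u @ v) = word_eval G r u \<otimes> word_eval G r v"
  proof (induction u)
    case Nil
    then show ?case using c[of v] by (simp add: word_eval_def)
  next
    case (Cons x u)
    obtain a b where x: "x = (a, b)" by (cases x)
    have e: "word_eval G r (x # w) = (if b then r a else inv (r a)) \<otimes> word_eval G r w" for w
      by (simp add: word_eval_def x)
    show ?case using Cons assms[of a] c[of u] c[of v]
      by (simp add: e m_assoc)
  qed
qed

lemma (in group) generate_subset_words:
  assumes "\<And>a. r a \<in> carrier G"
  shows "generate G (range r) \<subseteq> range (word_eval G r)"
proof
  fix h assume "h \<in> generate G (range r)"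
  then show "h \<in> range (word_eval G r)"
  proof (induction rule: generate.induct)
    case one
    have "word_eval G r [] = \<one>" by (simp add: word_eval_def)
    then show ?case by (metis rangeI)
  next
    case (incl h)
    then obtain a where "h = r a" by auto
    then have "word_eval G r [(a, True)] = h" using assms by (simp add: word_eval_def)
    then show ?case by (metis rangeI)
  next
    case (inv h)
    then obtain a where "h = r a" by auto
    then have "word_eval G r [(a, False)] = inv h" using assms by (simp add: word_eval_def)
    then show ?case by (metis rangeI)
  next
    case (eng h1 h2)
    then obtain u v where "h1 = word_eval G r u" "h2 = word_eval G r v" by auto
    then have "word_eval G r (u @ v) = h1 \<otimes> h2" using word_eval_append[OF assms] by simp
    then show ?case by (metis rangeI)
  qed
qed

lemma capableI:
  fixes G :: "('a, 'm) monoid_scheme" and H :: "('h, 'n) monoid_scheme"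
  assumes G: "group G" and H: "group H" and iso: "G \<cong> H Mod group_center H"
  shows "capable G"
proof -
  interpret G: group G by fact
  interpret H: group H by fact
  define Z where "Z = group_center H"
  interpret Z: normal Z H unfolding Z_def by (rule H.group_center_normal)
  obtain \<phi> where \<phi>: "\<phi> \<in> iso G (H Mod Z)" using iso by (auto simp: is_iso_def Z_def)
  have \<phi>_surj: "\<phi> ` carrier G = carrier (H Mod Z)"
    using \<phi> by (auto simp: iso_def bij_betw_def)
  define r where "r a = (if a \<in> carrier G then SOME h. h \<in> carrier H \<and> \<phi> a = Z #>\<^bsub>H\<^esub> h else \<one>\<^bsub>H\<^esub>)" for a
  have r: "r a \<in> carrier H \<and> \<phi> a = Z #>\<^bsub>H\<^esub> r a" if "a \<in> carrier G" for a
  proof -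
    have "\<phi> a \<in> carrier (H Mod Z)" using that \<phi>_surj by auto
    then have "\<exists>h. h \<in> carrier H \<and> \<phi> a = Z #>\<^bsub>H\<^esub> h" by (auto simp: carrier_FactGroup)
    from someI_ex[OF this] show ?thesis using that by (simp add: r_def)
  qed
  have rc: "r a \<in> carrier H" for a
    using r[of a] by (cases "a \<in> carrier G") (auto simp: r_def)
  define K where "K = generate H (range r)"
  have Ksub: "subgroup K H" unfolding K_def using rc by (intro H.generate_is_subgroup) auto
  interpret K: subgroup K H by fact
  define f where "f = inv_into UNIV (word_eval H r)"
  have ff: "word_eval H r (f k) = k" if "k \<in> K" for k
    using that H.generate_subset_words[of r] rc unfolding f_def K_def
    by (meson f_inv_into_f subsetD)
  define g where "g = word_eval H r"
  have gf: "g (f k) = k" if "k \<in> K" for k using ff[OF that] by (simp add: g_def)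
  define L :: "('a \<times> bool) list monoid" where
    "L = \<lparr>carrier = f ` K, monoid.mult = (\<lambda>u v. f (g u \<otimes>\<^bsub>H\<^esub> g v)), one = f \<one>\<^bsub>H\<^esub>\<rparr>"
  have gc: "g u \<in> K" if "u \<in> carrier L" for u using that gf by (auto simp: L_def)
  have gcH: "g u \<in> carrier H" if "u \<in> carrier L" for u using gc[OF that] by auto
  have gm: "g (u \<otimes>\<^bsub>L\<^esub> v) = g u \<otimes>\<^bsub>H\<^esub> g v" if "u \<in> carrier L" "v \<in> carrier L" for u v
    using gc[OF that(1)] gc[OF that(2)] gf by (simp add: L_def)
  have ginj: "u = v" if uv: "u \<in> carrier L" "v \<in> carrier L" "g u = g v" for u v
  proof -
    obtain k l where "k \<in> K" "u = f k" "l \<in> K" "v = f l" using uv by (auto simp: L_def)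
    then show ?thesis using uv(3) gf[of k] gf[of l] by metis
  qed
  have gimg: "g ` carrier L = K" unfolding L_def by (simp add: image_image gf)
  have L: "group L"
  proof (rule groupI)
    fix u v assume u: "u \<in> carrier L" and v: "v \<in> carrier L"
    then show uv: "u \<otimes>\<^bsub>L\<^esub> v \<in> carrier L" using gc by (simp add: L_def)
  next
    show "\<one>\<^bsub>L\<^esub> \<in> carrier L" by (simp add: L_def)
  next
    fix u v w assume u: "u \<in> carrier L" and v: "v \<in> carrier L" and w: "w \<in> carrier L"
    have cl: "\<And>a b. a \<in> carrier L \<Longrightarrow> b \<in> carrier L \<Longrightarrow> a \<otimes>\<^bsub>L\<^esub> b \<in> carrier L"
      using gc by (simp add: L_def)
    show "u \<otimes>\<^bsub>L\<^esub> v \<otimes>\<^bsub>L\<^esub> w = u \<otimes>\<^bsub>L\<^esub> (v \<otimes>\<^bsub>L\<^esub> w)"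
      by (rule ginj) (use u v w cl gm gcH in \<open>simp_all add: H.m_assoc\<close>)
  next
    fix u assume u: "u \<in> carrier L"
    have o: "\<one>\<^bsub>L\<^esub> \<in> carrier L" and go: "g \<one>\<^bsub>L\<^esub> = \<one>\<^bsub>H\<^esub>" using gf by (simp_all add: L_def)
    have cl: "\<And>a b. a \<in> carrier L \<Longrightarrow> b \<in> carrier L \<Longrightarrow> a \<otimes>\<^bsub>L\<^esub> b \<in> carrier L"
      using gc by (simp add: L_def)
    show "\<one>\<^bsub>L\<^esub> \<otimes>\<^bsub>L\<^esub> u = u"
      by (rule ginj) (use u o go cl gm gcH in simp_all)
    have "inv\<^bsub>H\<^esub> g u \<in> K" using gc[OF u] by auto
    then obtain v where v: "v \<in> carrier L" "g v = inv\<^bsub>H\<^esub> g u" using gimg by (metis imageE)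
    have "v \<otimes>\<^bsub>L\<^esub> u = \<one>\<^bsub>L\<^esub>"
      by (rule ginj) (use u v o go cl gm gcH in simp_all)
    then show "\<exists>v \<in> carrier L. v \<otimes>\<^bsub>L\<^esub> u = \<one>\<^bsub>L\<^esub>" using v by auto
  qed
  interpret L: group L by fact
  define \<psi> where "\<psi> u = Z #>\<^bsub>H\<^esub> g u" for u
  interpret Q: group "H Mod Z" by (rule Z.factorgroup_is_group)
  have "\<psi> \<in> hom L (H Mod Z)"
    by (rule homI) (auto simp: \<psi>_def carrier_FactGroup gcH gm Z.rcos_sum)
  then interpret \<psi>: group_hom L "H Mod Z" \<psi>
    by (simp add: group_hom_def group_hom_axioms_def L Q.group_axioms)
  have surj: "\<psi> ` carrier L = carrier (H Mod Z)"
  proof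
    show "\<psi> ` carrier L \<subseteq> carrier (H Mod Z)" by auto
    show "carrier (H Mod Z) \<subseteq> \<psi> ` carrier L"
    proof
      fix c assume "c \<in> carrier (H Mod Z)"
      then obtain a where a: "a \<in> carrier G" "c = \<phi> a" using \<phi>_surj by auto
      have "r a \<in> K" unfolding K_def by (rule generate.incl) auto
      then obtain u where "u \<in> carrier L" "g u = r a" unfolding gimg[symmetric] by auto
      moreover from this have "c = \<psi> u" using a r[OF a(1)] by (simp add: \<psi>_def)
      ultimately show "c \<in> \<psi> ` carrier L" by blast
    qed
  qed
  have KZ: "\<exists>k\<in>K. \<exists>z\<in>Z. h = z \<otimes>\<^bsub>H\<^esub> k" if h: "h \<in> carrier H" for h
  proof -
    have "Z #>\<^bsub>H\<^esub> h \<in> \<psi> ` carrier L" using h surj by (simp add: carrier_FactGroup)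
    then obtain u where u: "u \<in> carrier L" "Z #>\<^bsub>H\<^esub> h = Z #>\<^bsub>H\<^esub> g u" by (auto simp: \<psi>_def)
    have "h \<in> Z #>\<^bsub>H\<^esub> h" using h Z.subgroup_axioms by (rule H.rcos_self)
    then show ?thesis using u gc[OF u(1)] by (auto simp: r_coset_def)
  qed
  have Zcomm: "z \<otimes>\<^bsub>H\<^esub> h = h \<otimes>\<^bsub>H\<^esub> z" if "z \<in> Z" "h \<in> carrier H" for z h
    using that unfolding Z_def group_center_def by blast
  have ZK: "k \<in> Z \<longleftrightarrow> (\<forall>l\<in>K. k \<otimes>\<^bsub>H\<^esub> l = l \<otimes>\<^bsub>H\<^esub> k)" if k: "k \<in> K" for k
  proof
    assume "k \<in> Z"
    then show "\<forall>l\<in>K. k \<otimes>\<^bsub>H\<^esub> l = l \<otimes>\<^bsub>H\<^esub> k" using Zcomm K.mem_carrier by blast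
  next
    assume c: "\<forall>l\<in>K. k \<otimes>\<^bsub>H\<^esub> l = l \<otimes>\<^bsub>H\<^esub> k"
    have "k \<otimes>\<^bsub>H\<^esub> h = h \<otimes>\<^bsub>H\<^esub> k" if h: "h \<in> carrier H" for h
    proof -
      obtain l z where lz: "l \<in> K" "z \<in> Z" "h = z \<otimes>\<^bsub>H\<^esub> l" using KZ[OF h] by auto
      have kc: "k \<in> carrier H" "l \<in> carrier H" "z \<in> carrier H" using k lz by auto
      have "k \<otimes>\<^bsub>H\<^esub> h = (k \<otimes>\<^bsub>H\<^esub> z) \<otimes>\<^bsub>H\<^esub> l" using kc lz by (simp add: H.m_assoc)
      also have "\<dots> = z \<otimes>\<^bsub>H\<^esub> (k \<otimes>\<^bsub>H\<^esub> l)" using Zcomm[OF lz(2) kc(1), symmetric] kc by (simp add: H.m_assoc)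
      also have "\<dots> = h \<otimes>\<^bsub>H\<^esub> k" using bspec[OF c lz(1)] lz(3) kc by (simp add: H.m_assoc)
      finally show ?thesis .
    qed
    then show "k \<in> Z" using K.mem_carrier[OF k] unfolding Z_def group_center_def by blast
  qed
  have ker: "kernel L (H Mod Z) \<psi> = group_center L"
  proof -
    have "\<psi> u = Z \<longleftrightarrow> g u \<in> Z" if "u \<in> carrier L" for u
      using gcH[OF that] H.rcos_self[OF _ Z.subgroup_axioms, of "g u"] H.coset_join2[OF _ Z.subgroup_axioms]
      by (auto simp: \<psi>_def)
    moreover have "g u \<in> Z \<longleftrightarrow> u \<in> group_center L" if u: "u \<in> carrier L" for u
    proof -
      have "g u \<in> Z \<longleftrightarrow> (\<forall>v\<in>carrier L. g u \<otimes>\<^bsub>H\<^esub> g v = g v \<otimes>\<^bsub>H\<^esub> g u)"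
        using ZK[OF gc[OF u]] gimg by auto
      also have "\<dots> \<longleftrightarrow> (\<forall>v\<in>carrier L. u \<otimes>\<^bsub>L\<^esub> v = v \<otimes>\<^bsub>L\<^esub> u)"
        using u gm ginj L.m_closed by metis
      finally show ?thesis using u by (simp add: group_center_def)
    qed
    moreover have "group_center L \<subseteq> carrier L" unfolding group_center_def by blast
    moreover have "kernel L (H Mod Z) \<psi> = {u \<in> carrier L. \<psi> u = Z}" by (simp add: kernel_def)
    ultimately show ?thesis by blast
  qed
  have "L Mod group_center L \<cong> H Mod Z"
    using \<psi>.FactGroup_iso[OF surj] by (simp add: ker)
  then have "H Mod Z \<cong> L Mod group_center L"
    using normal.factorgroup_is_group[OF L.group_center_normal] by (rule group.iso_sym[rotated])
  then have "G \<cong> L Mod group_center L" using iso unfolding Z_def[symmetric] by (rule iso_trans[rotated])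
  with L show ?thesis unfolding capable_def by blast
qed

section \<open>Nilpotency class, exponent, and minimal generation\<close>

text \<open>With the commutator convention of \<^const>\<open>derived\<close>.  The indexing starts at \<open>0\<close>:
  \<open>lower_central G k\<close> is the usual $G_{k+1}$, so class \<open>c\<close> means that
  \<open>c\<close> is the first index at which the series is trivial.\<close>

fun lower_central :: "('a, 'm) monoid_scheme \<Rightarrow> nat \<Rightarrow> 'a set" where
  "lower_central G 0 = carrier G"
| "lower_central G (Suc k) = generate G
     (\<Union>x \<in> lower_central G k. \<Union>y \<in> carrier G. {x \<otimes>\<^bsub>G\<^esub> y \<otimes>\<^bsub>G\<^esub> inv\<^bsub>G\<^esub> x \<otimes>\<^bsub>G\<^esub> inv\<^bsub>G\<^esub> y})"

definition nilpotent_of_class :: "('a, 'm) monoid_scheme \<Rightarrow> nat \<Rightarrow> bool" where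
  "nilpotent_of_class G c \<longleftrightarrow>
     lower_central G c = {\<one>\<^bsub>G\<^esub>} \<and> (\<forall>k < c. lower_central G k \<noteq> {\<one>\<^bsub>G\<^esub>})"

definition has_exponent :: "('a, 'm) monoid_scheme \<Rightarrow> nat \<Rightarrow> bool" where
  "has_exponent G e \<longleftrightarrow> 0 < e \<and> (\<forall>x \<in> carrier G. x [^]\<^bsub>G\<^esub> e = \<one>\<^bsub>G\<^esub>) \<and>
     (\<forall>d. 0 < d \<and> d < e \<longrightarrow> (\<exists>x \<in> carrier G. x [^]\<^bsub>G\<^esub> d \<noteq> \<one>\<^bsub>G\<^esub>))"

definition minimally_generated_by ::
    "('a, 'm) monoid_scheme \<Rightarrow> nat \<Rightarrow> (nat \<Rightarrow> 'a) \<Rightarrow> bool" where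
  "minimally_generated_by G n x \<longleftrightarrow>
     x ` {1..n} \<subseteq> carrier G \<and> generate G (x ` {1..n}) = carrier G \<and>
     (\<forall>S. finite S \<and> S \<subseteq> carrier G \<and> generate G S = carrier G \<longrightarrow> n \<le> card S)"

section \<open>The commutator subgroup as a vector space\<close>

text \<open>The additive group of the module is the subgroup \<open>D\<close> of \<open>G\<close> and scalars act by powers.
  The multiplicative fields of the module record are irrelevant.\<close>

definition power_module :: "('a, 'm) monoid_scheme \<Rightarrow> 'a set \<Rightarrow> (int, 'a) module" where
  "power_module G D =
     \<lparr>carrier = D, monoid.mult = monoid.mult G, one = \<one>\<^bsub>G\<^esub>,
      zero = \<one>\<^bsub>G\<^esub>, add = monoid.mult G, smult = (\<lambda>k x. x [^]\<^bsub>G\<^esub> k)\<rparr>"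

lemma (in group) vectorspace_power_module:
  assumes p: "prime p" and D: "subgroup D G"
    and comm: "\<And>x y. x \<in> D \<Longrightarrow> y \<in> D \<Longrightarrow> x \<otimes> y = y \<otimes> x"
    and exp: "\<And>x. x \<in> D \<Longrightarrow> x [^] p = \<one>"
  shows "vectorspace (residue_ring (int p)) (power_module G D)"
proof -
  let ?R = "residue_ring (int p)"
  interpret R: residues_prime p ?R by unfold_locales (use p in auto)
  interpret D: subgroup D G by fact
  have expm: "x [^] (k mod int p) = x [^] k" if x: "x \<in> D" for x and k :: int
  proof -
    have "x [^] k = x [^] (int p * (k div int p) + k mod int p)" by simp
    also have "\<dots> = (x [^] int p) [^] (k div int p) \<otimes> x [^] (k mod int p)"
      using x by (simp only: int_pow_mult int_pow_pow D.mem_carrier)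
    also have "x [^] int p = \<one>" using exp[OF x] by (simp add: int_pow_int)
    finally show ?thesis using x by simp
  qed
  have "abelian_group (power_module G D)"
  proof (rule abelian_groupI)
    fix x assume "x \<in> carrier (power_module G D)"
    then show "\<exists>y\<in>carrier (power_module G D). y \<oplus>\<^bsub>power_module G D\<^esub> x = \<zero>\<^bsub>power_module G D\<^esub>"
      by (intro bexI[of _ "inv x"]) (auto simp: power_module_def)
  qed (auto simp: power_module_def m_assoc intro: comm)
  moreover have "module_axioms ?R (power_module G D)"
  proof (unfold_locales, goal_cases)
    case (1 a x) 
    then show ?case using subgroup_int_pow_closed[OF D] by (simp add: power_module_def)
  next
    case (2 a b x)
    then show ?case by (simp add: power_module_def R.res_add_eq expm int_pow_mult)
  next
    case (3 a x y)
    then show ?case by (simp add: power_module_def int_pow_mult_distrib comm)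
  next
    case (4 a b x)
    then show ?case by (simp add: power_module_def R.res_mult_eq expm int_pow_pow mult.commute)
  next
    case (5 x)
    then show ?case by (simp add: power_module_def R.res_one_eq)
  qed
  ultimately show ?thesis
    by (simp add: vectorspace_def module_def R.cring R.is_field)
qed

end

theory Submission
  imports Defs
begin

text \<open>Let \<open>G\<close> have class two and odd prime exponent \<open>p\<close>, and let \<open>V = G/[G,G]\<close>, an
\<open>n\<close>-dimensional space over the field with \<open>p\<close> elements.  The argument turns capability into a
statement on alternating forms on the dual of \<open>V\<close>.

\<^bold>\<open>Cocycles.\<close>  In the central extension of \<open>G\<close> given by a cocycle \<open>f\<close> with values modulo \<open>p\<close>, a
central element \<open>z\<close> of \<open>G\<close> lifts to a noncentral element iff \<open>f(z,h)\<close> differs from \<open>f(h,z)\<close>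
for some \<open>h\<close>.  Hence, if every nontrivial \<open>z\<close> in the centre is detected in this way by some
cocycle, the extension given by all these cocycles at once has centre exactly the kernel of its
projection to \<open>G\<close>, and \<open>G\<close> is capable (\<open>capable_if_cocycles_detect_center\<close>).

\<^bold>\<open>Detecting cocycles come from the Heisenberg group.\<close>  For odd \<open>p\<close> the Heisenberg group modulo
\<open>p\<close> is itself capable: it is the central quotient of the semidirect product of the space of
binary quadratic forms with a cyclic group of unipotent substitutions.  Pulling this extension
back along a homomorphism \<open>(\<alpha>, \<mu>, \<gamma>)\<close> from \<open>G\<close> to the Heisenberg group gives an explicit cocycle
on \<open>G\<close> (\<open>heisenberg_cocycle\<close>).  If the linear forms \<open>\<alpha>, \<mu>\<close> are independent, both vanish on a
central \<open>z\<close>, and the cocycle detects \<open>z\<close> as soon as \<open>\<gamma>(z)\<close> is nonzero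
(\<open>heisenberg_cocycle_detects\<close>).  The construction is uniform in \<open>p\<close>; in particular \<open>p = 3\<close>
is not exceptional.

\<^bold>\<open>Existence of the maps.\<close>  The product \<open>g h [h,g]\<^sup>1\<^sup>/\<^sup>2\<close> (Baer) makes \<open>G\<close> an elementary abelian
group with the same generators and the same commutators.  By minimality of the generating
set, the \<open>x\<^sub>i\<close> together with the commutators \<open>[x\<^sub>i,x\<^sub>j]\<close>, \<open>i < j\<close>, generate it subject only to the
linear relations \<open>X\<close> among the commutators (\<open>relation_coefficients\<close>).  So linear forms
\<open>l, m\<close> on \<open>V\<close> are the first two components of a map to the Heisenberg group iff the decomposable
form \<open>l \<and> m\<close> kills \<open>X\<close>, and then \<open>\<gamma>\<close> may be prescribed on the \<open>x\<^sub>i\<close> (\<open>heisenberg_map\<close>).  This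
freedom takes care of central elements outside \<open>[G,G]\<close>.  For an element of \<open>[G,G]\<close> represented by
a bivector \<open>b\<close> outside \<open>X\<close>, one needs \<open>l, m\<close> with \<open>l \<and> m\<close> zero on \<open>X\<close> and nonzero on \<open>b\<close>.

\<^bold>\<open>Linear algebra.\<close>  The bound on the dimension of \<open>[G,G]\<close> says that \<open>X\<close> is spanned by at most two bivectors
\<open>u, v\<close>.  Reading bivectors as alternating forms in \<open>(l, m)\<close>, what is left to show is: if \<open>b\<close>
vanishes wherever \<open>u\<close> and \<open>v\<close> both vanish, then \<open>b\<close> is a combination of \<open>u\<close> and \<open>v\<close>
(\<open>alternating_form_vanishing_with_two\<close>).  If some \<open>e\<close> has \<open>u(e,_)\<close> and \<open>v(e,_)\<close> independent,
then subtracting a combination of \<open>u\<close> and \<open>v\<close> from \<open>b\<close> gives \<open>b(e,_) = 0\<close>.  Now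
\<open>b(l,m) = b(l + s e, m + t e)\<close>, and the scalars \<open>s, t\<close> can be chosen to make \<open>u\<close> and \<open>v\<close>
vanish unless \<open>(u(e,l), v(e,l))\<close> and \<open>(u(e,m), v(e,m))\<close> are dependent; such pairs are reached from the
others by bilinearity, so \<open>b = 0\<close>.  If no such \<open>e\<close> exists, \<open>u\<close> and \<open>v\<close> are proportional, and the same
argument with one form applies.

The field with \<open>p\<close> elements is represented throughout by integers modulo \<open>p\<close>.\<close>


section \<open>Pencils of alternating forms modulo a prime\<close>

text \<open>The explicit coefficients certify ideal membership modulo \<open>p\<close>, reducing each step of the linear
algebra below to an identity of integers.\<close>

lemma dvd_combine:
  fixes p :: int
  assumes "p dvd a" "p dvd b" "x = r * a + s * b"
  shows "p dvd x"
  using assms by simp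

lemma dvd_combine3:
  fixes p :: int
  assumes "p dvd a" "p dvd b" "p dvd c" "x = r * a + s * b + t * c"
  shows "p dvd x"
  using assms by simp

lemma inverse_mod_prime:
  fixes p a :: int
  assumes "prime p" "\<not> p dvd a"
  obtains k where "p dvd k * a - 1"
proof -
  have "coprime a p" using assms prime_imp_coprime coprime_commute by blast
  then obtain k where "[a * k = 1] (mod p)" using cong_solve_coprime_int by blast
  then show ?thesis using that[of k] by (simp add: cong_iff_dvd_diff mult.commute)
qed

lemma cramer_mod_prime:
  fixes p :: int
  assumes "prime p" "\<not> p dvd a * d - b * c"
  obtains s t where "p dvd a * s + b * t - e" "p dvd c * s + d * t - f"
proof -
  obtain k where k: "p dvd k * (a * d - b * c) - 1" using inverse_mod_prime[OF assms] .
  show ?thesis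
  proof (rule that[of "k * (e * d - b * f)" "k * (a * f - c * e)"])
    show "p dvd a * (k * (e * d - b * f)) + b * (k * (a * f - c * e)) - e"
      by (rule dvd_combine[OF k dvd_0_right, where r = "e" and s = 0]) (simp add: algebra_simps)
    show "p dvd c * (k * (e * d - b * f)) + d * (k * (a * f - c * e)) - f"
      by (rule dvd_combine[OF k dvd_0_right, where r = "f" and s = 0]) (simp add: algebra_simps)
  qed
qed

text \<open>The forms are exactly bilinear over the integers, and only their values are read modulo \<open>p\<close>.
Linearity is stated for the update \<open>l + k u\<close>, the only operation on vectors that occurs (a sum appears as an
update with coefficient \<open>1\<close>); linearity in the second argument and vanishing on the diagonal follow from skew symmetry.\<close>

definition alternating :: "(('i \<Rightarrow> int) \<Rightarrow> ('i \<Rightarrow> int) \<Rightarrow> int) \<Rightarrow> bool" where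
  "alternating x \<longleftrightarrow>
     (\<forall>l u m k. x (\<lambda>i. l i + k * u i) m = x l m + k * x u m) \<and> (\<forall>l m. x m l = - x l m)"

lemma alternating_simps:
  assumes "alternating x"
  shows "x (\<lambda>i. l i + k * u i) m = x l m + k * x u m"
    and "x m (\<lambda>i. l i + k * u i) = x m l + k * x m u"
    and "x l l = 0"
proof -
  have a: "x (\<lambda>i. l i + k * u i) m = x l m + k * x u m" and s: "x m l = - x l m" for l u m k
    using assms unfolding alternating_def by blast+
  show "x (\<lambda>i. l i + k * u i) m = x l m + k * x u m" by (rule a)
  show "x m (\<lambda>i. l i + k * u i) = x m l + k * x m u" using a s by (metis minus_add_distrib mult_minus_right)
  show "x l l = 0" using s[of l l] by simp
qed

lemma alternating_skew: "alternating x \<Longrightarrow> x m l = - x l m"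
  unfolding alternating_def by blast

lemma alternating_diff:
  fixes x y :: "('i \<Rightarrow> int) \<Rightarrow> ('i \<Rightarrow> int) \<Rightarrow> int"
  assumes "alternating x" "alternating y"
  shows "alternating (\<lambda>l m. x l m - c * y l m)"
  unfolding alternating_def
proof (intro conjI allI)
  fix l u m :: "'i \<Rightarrow> int" and k
  show "x (\<lambda>i. l i + k * u i) m - c * y (\<lambda>i. l i + k * u i) m = x l m - c * y l m + k * (x u m - c * y u m)"
    by (simp only: alternating_simps[OF assms(1)] alternating_simps[OF assms(2)])
      (simp add: algebra_simps)
  show "x m l - c * y m l = - (x l m - c * y l m)"
    using alternating_skew[OF assms(1), of m l] alternating_skew[OF assms(2), of m l] by simp
qed

text \<open>The model case of the shift argument: after subtracting a multiple of \<open>x\<close>, the form \<open>b\<close> does not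
change under \<open>l \<mapsto> l + s u\<close>, and such a shift reaches the zero set of \<open>x\<close> whenever
\<open>x u m\<close> is invertible; the remaining \<open>m\<close> are moved off this exceptional hyperplane by adding \<open>v\<close>.\<close>

lemma alternating_form_vanishing_with_one:
  fixes p :: int
  assumes p: "prime p" and x: "alternating x" and b: "alternating b"
    and van: "\<And>l m. p dvd x l m \<Longrightarrow> p dvd b l m"
  obtains c where "\<And>l m. p dvd b l m - c * x l m"
proof (cases "\<exists>u v. \<not> p dvd x u v")
  case False
  then show ?thesis using van that[of 0] by simp
next
  case True
  then obtain u v where uv: "\<not> p dvd x u v" by blast
  obtain k where k: "p dvd k * x u v - 1" using inverse_mod_prime[OF p uv] .
  define c where "c = k * b u v"
  define b' where "b' = (\<lambda>l m. b l m - c * x l m)"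
  have b': "alternating b'" unfolding b'_def by (rule alternating_diff[OF b x])
  have van': "p dvd b' l m" if "p dvd x l m" for l m
    using that van[OF that] by (simp add: b'_def)
  have b'uv: "p dvd b' u v" unfolding b'_def c_def
    by (rule dvd_combine[OF k dvd_0_right, where r = "- b u v" and s = 0]) (simp add: algebra_simps)
  have b'u: "p dvd b' u m" for m
  proof -
    define s where "s = k * x u m"
    have "p dvd x u m - s * x u v" unfolding s_def
      by (rule dvd_combine[OF k dvd_0_right, where r = "- x u m" and s = 0])
        (simp add: algebra_simps)
    then have "p dvd x u (\<lambda>i. m i + (-s) * v i)" by (simp only: alternating_simps[OF x]) simp
    from van'[OF this] have h: "p dvd b' u m - s * b' u v"
      by (simp only: alternating_simps[OF b']) simp
    show ?thesis
      by (rule dvd_combine[OF h b'uv, where r = "1" and s = "s"])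
        (simp add: algebra_simps)
  qed
  have main: "p dvd b' l m" if um: "\<not> p dvd x u m" for l m
  proof -
    obtain j where j: "p dvd j * x u m - 1" using inverse_mod_prime[OF p um] .
    define s where "s = - j * x l m"
    have "p dvd x l m + s * x u m" unfolding s_def
      by (rule dvd_combine[OF j dvd_0_right, where r = "- x l m" and s = 0])
        (simp add: algebra_simps)
    then have "p dvd x (\<lambda>i. l i + s * u i) m" by (simp only: alternating_simps[OF x])
    from van'[OF this] have h: "p dvd b' l m + s * b' u m" by (simp only: alternating_simps[OF b'])
    show ?thesis
      by (rule dvd_combine[OF h b'u[of m], where r = "1" and s = "-s"])
        (simp add: algebra_simps)
  qed
  have "p dvd b' l m" for l m
  proof (cases "p dvd x u m")
    case True
    have "\<not> p dvd x u (\<lambda>i. m i + 1 * v i)"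
      using True uv by (simp only: alternating_simps[OF x]) (metis dvd_add_right_iff mult_1)
    from main[OF this, of l] have h: "p dvd b' l m + 1 * b' l v"
      by (simp only: alternating_simps[OF b'])
    show ?thesis
      by (rule dvd_combine[OF h main[OF uv, of l], where r = "1" and s = "-1"])
        (simp add: algebra_simps)
  qed (rule main)
  then show ?thesis using that[of c] by (simp add: b'_def)
qed

text \<open>Here \<open>m \<mapsto> (x u m, y u m)\<close> is a surjection \<open>\<pi>\<close> onto the plane, \<open>v\<close> and \<open>w\<close> mapping to a basis.  After \<open>b\<close>
is corrected so that it vanishes on \<open>u\<close>, shifting both arguments by multiples of \<open>u\<close> reaches the common
zeros of \<open>x\<close> and \<open>y\<close> whenever \<open>\<pi> l\<close> and \<open>\<pi> m\<close> are independent.  This makes the kernel of \<open>\<pi>\<close> part of the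
radical of \<open>b\<close>, and \<open>b v w\<close> vanishes as well.\<close>

lemma alternating_form_vanishing_with_two_independent:
  fixes p :: int
  assumes p: "prime p" and x: "alternating x" and y: "alternating y" and b: "alternating b"
    and van: "\<And>l m. p dvd x l m \<Longrightarrow> p dvd y l m \<Longrightarrow> p dvd b l m"
    and uvw: "\<not> p dvd x u v * y u w - x u w * y u v"
  obtains c d where "\<And>l m. p dvd b l m - c * x l m - d * y l m"
proof -
  have "\<not> p dvd x u v * y u w - y u v * x u w" using uvw by (simp add: mult.commute)
  from cramer_mod_prime[OF p this] obtain c d where
    cd: "p dvd x u v * c + y u v * d - b u v" "p dvd x u w * c + y u w * d - b u w" .
  define b' where "b' = (\<lambda>l m. (b l m - c * x l m) - d * y l m)"
  have b': "alternating b'" unfolding b'_def by (intro alternating_diff b x y)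
  have van': "p dvd b' l m" if "p dvd x l m" "p dvd y l m" for l m
    using that van[OF that] by (simp add: b'_def)
  \<comment> \<open>With these two values \<open>b'\<close> vanishes on \<open>u\<close> altogether, because \<open>v\<close> and \<open>w\<close> span a complement of \<open>ker \<pi>\<close> and
\<open>b'\<close> kills \<open>u\<close> paired with the kernel.\<close>
  have b'uv: "p dvd b' u v" "p dvd b' u w" unfolding b'_def
    subgoal
      by (rule dvd_combine[OF cd(1) dvd_0_right, where r = "-1" and s = 0])
        (simp add: algebra_simps)
    subgoal
      by (rule dvd_combine[OF cd(2) dvd_0_right, where r = "-1" and s = 0])
        (simp add: algebra_simps)
    done
  \<comment> \<open>Any vector is moved into \<open>ker \<pi>\<close> along \<open>v\<close> and \<open>w\<close>.\<close>
  have coords: "\<exists>s t. p dvd x u (\<lambda>i. (\<lambda>i. m i + s * v i) i + t * w i) \<and>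
      p dvd y u (\<lambda>i. (\<lambda>i. m i + s * v i) i + t * w i)" for m
  proof -
    obtain s t where "p dvd x u v * s + x u w * t - (- x u m)" "p dvd y u v * s + y u w * t - (- y u m)"
      using cramer_mod_prime[OF p uvw] .
    then show ?thesis by (simp only: alternating_simps[OF x] alternating_simps[OF y]) (auto simp: algebra_simps)
  qed
  have b'u: "p dvd b' u m" for m
  proof -
    obtain s t where "p dvd x u (\<lambda>i. (\<lambda>i. m i + s * v i) i + t * w i)"
      "p dvd y u (\<lambda>i. (\<lambda>i. m i + s * v i) i + t * w i)" using coords by blast
    from van'[OF this] have h: "p dvd b' u m + s * b' u v + t * b' u w"
      by (simp only: alternating_simps[OF b'])
    show ?thesis
      by (rule dvd_combine3[OF h b'uv(1) b'uv(2), where r = "1" and s = "-s" and t = "-t"])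
        (simp add: algebra_simps)
  qed
  have main: "p dvd b' l m" if lm: "\<not> p dvd x u l * y u m - x u m * y u l" for l m
  proof -
    have "\<not> p dvd x u m * (- y u l) - (- x u l) * y u m" using lm
      by (simp add: algebra_simps)
    from cramer_mod_prime[OF p this] obtain s t where
      st: "p dvd x u m * s + (- x u l) * t - (- x l m)" "p dvd y u m * s + (- y u l) * t - (- y l m)" .
    have "p dvd x (\<lambda>i. l i + s * u i) (\<lambda>i. m i + t * u i)"
      using st(1) alternating_skew[OF x, of l u]
      by (simp only: alternating_simps[OF x]) (simp add: algebra_simps)
    moreover have "p dvd y (\<lambda>i. l i + s * u i) (\<lambda>i. m i + t * u i)"
      using st(2) alternating_skew[OF y, of l u]
      by (simp only: alternating_simps[OF y]) (simp add: algebra_simps)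
    ultimately have "p dvd b' (\<lambda>i. l i + s * u i) (\<lambda>i. m i + t * u i)" by (rule van')
    then have "p dvd (b' l m + t * b' l u) + s * (b' u m + t * 0)"
      by (simp only: alternating_simps[OF b'])
    then have h: "p dvd b' l m + s * b' u m - t * b' u l"
      using alternating_skew[OF b', of l u] by (simp add: algebra_simps)
    show ?thesis
      by (rule dvd_combine3[OF h b'u[of m] b'u[of l], where r = "1" and s = "-s" and t = "t"])
        (simp add: algebra_simps)
  qed
  have ker1: "p dvd b' m l" if m: "p dvd x u m" "p dvd y u m" and l: "\<not> (p dvd x u l \<and> p dvd y u l)" for m l
  proof -
    have "\<exists>n. \<not> p dvd x u n * y u l - x u l * y u n"
    proof (rule ccontr)
      assume "\<nexists>n. \<not> p dvd x u n * y u l - x u l * y u n"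
      then have h: "p dvd x u v * y u l - x u l * y u v" "p dvd x u w * y u l - x u l * y u w" by blast+
      have "p dvd (x u v * y u w - x u w * y u v) * x u l"
        by (rule dvd_combine[OF h(1) h(2), where r = "x u w" and s = "- x u v"])
          (simp add: algebra_simps)
      moreover have "p dvd (x u v * y u w - x u w * y u v) * y u l"
        by (rule dvd_combine[OF h(1) h(2), where r = "y u w" and s = "- y u v"])
          (simp add: algebra_simps)
      ultimately have "p dvd x u l" "p dvd y u l"
        using uvw p by (meson prime_dvd_multD)+
      then show False using l by blast
    qed
    then obtain n where n: "\<not> p dvd x u n * y u l - x u l * y u n" by blast
    have "\<not> p dvd x u (\<lambda>i. n i + 1 * m i) * y u l - x u l * y u (\<lambda>i. n i + 1 * m i)"
    proof
      assume "p dvd x u (\<lambda>i. n i + 1 * m i) * y u l - x u l * y u (\<lambda>i. n i + 1 * m i)"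
      then have h: "p dvd (x u n + 1 * x u m) * y u l - x u l * (y u n + 1 * y u m)"
        by (simp only: alternating_simps[OF x] alternating_simps[OF y])
      have "p dvd x u n * y u l - x u l * y u n"
        by (rule dvd_combine3[OF h m(1) m(2), where r = "1" and s = "- y u l" and t = "x u l"])
          (simp add: algebra_simps)
      with n show False by blast
    qed
    from main[OF this] have h: "p dvd b' n l + 1 * b' m l" by (simp only: alternating_simps[OF b'])
    show ?thesis
      by (rule dvd_combine[OF h main[OF n], where r = "1" and s = "-1"])
        (simp add: algebra_simps)
  qed
  have v: "\<not> (p dvd x u v \<and> p dvd y u v)" using uvw by (auto simp: dvd_diff)
  have ker: "p dvd b' m l" if m: "p dvd x u m" "p dvd y u m" for m l
  proof (cases "p dvd x u l \<and> p dvd y u l")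
    case True
    have "\<not> (p dvd x u (\<lambda>i. l i + 1 * v i) \<and> p dvd y u (\<lambda>i. l i + 1 * v i))"
      using True v by (simp only: alternating_simps[OF x] alternating_simps[OF y])
        (metis dvd_add_right_iff mult_1)
    from ker1[OF m this] have h: "p dvd b' m l + 1 * b' m v" by (simp only: alternating_simps[OF b'])
    show ?thesis
      by (rule dvd_combine[OF h ker1[OF m v], where r = "1" and s = "-1"])
        (simp add: algebra_simps)
  qed (rule ker1[OF m])
  have vw: "p dvd b' v w" using main uvw by blast
  have vl: "p dvd b' v m" "p dvd b' w m" for m
  proof -
    obtain s t where "p dvd x u (\<lambda>i. (\<lambda>i. m i + s * v i) i + t * w i)"
      "p dvd y u (\<lambda>i. (\<lambda>i. m i + s * v i) i + t * w i)" using coords by blast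
    note k = ker[OF this]
    have h: "p dvd b' m v + s * b' v v + t * b' w v" "p dvd b' m w + s * b' v w + t * b' w w"
      using k[of v] k[of w] by (simp_all only: alternating_simps[OF b'])
    have h': "b' v m = - b' m v" "b' w m = - b' m w" "b' w v = - b' v w" "b' v v = 0" "b' w w = 0"
      by (rule alternating_skew[OF b'] alternating_simps(3)[OF b'])+
    show "p dvd b' v m" by (rule dvd_combine[OF h(1) vw, where r = "-1" and s = "-t"]) (simp add: h')
    show "p dvd b' w m" by (rule dvd_combine[OF h(2) vw, where r = "-1" and s = "s"]) (simp add: h')
  qed
  have "p dvd b' m l" for m l
  proof -
    obtain s t where "p dvd x u (\<lambda>i. (\<lambda>i. m i + s * v i) i + t * w i)"
      "p dvd y u (\<lambda>i. (\<lambda>i. m i + s * v i) i + t * w i)" using coords by blast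
    from ker[OF this] have h: "p dvd b' m l + s * b' v l + t * b' w l"
      by (simp only: alternating_simps[OF b'])
    show ?thesis
      by (rule dvd_combine3[OF h vl(1)[of l] vl(2)[of l], where r = "1" and s = "-s" and t = "-t"])
        (simp add: algebra_simps)
  qed
  then show ?thesis using that[of c d] by (simp add: b'_def)
qed

text \<open>What remains is the degenerate pencil, in which \<open>x u\<close> and \<open>y u\<close> are dependent for every \<open>u\<close>.  Then one
of the two forms is a multiple of the other, and the lemma on a single form applies.\<close>

lemma alternating_form_vanishing_with_two:
  fixes p :: int
  assumes p: "prime p" and x: "alternating x" and y: "alternating y" and b: "alternating b"
    and van: "\<And>l m. p dvd x l m \<Longrightarrow> p dvd y l m \<Longrightarrow> p dvd b l m"
  obtains c d where "\<And>l m. p dvd b l m - c * x l m - d * y l m"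
proof -
  consider (indep) u v w where "\<not> p dvd x u v * y u w - x u w * y u v"
    | (zero) "\<And>l m. p dvd x l m"
    | (dep) u v where "\<And>u v w. p dvd x u v * y u w - x u w * y u v" "\<not> p dvd x u v"
    by blast
  then show ?thesis
  proof cases
    case indep
    show ?thesis
    proof (rule alternating_form_vanishing_with_two_independent[OF p x y b])
      show "\<not> p dvd x u v * y u w - x u w * y u v" by (rule indep)
      show "p dvd b l m" if "p dvd x l m" "p dvd y l m" for l m using that by (rule van)
    qed (rule that)
  next
    case zero
    show ?thesis
    proof (rule alternating_form_vanishing_with_one[OF p y b])
      show "p dvd b l m" if "p dvd y l m" for l m using zero that by (rule van)
    next
      fix d assume "p dvd b l m - d * y l m" for l m
      then show ?thesis using that[of 0 d] by simp
    qed
  next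
    case dep
    obtain k where k: "p dvd k * x u v - 1" using inverse_mod_prime[OF p dep(2)] .
    define c where "c = k * y u v"
    define y' where "y' = (\<lambda>l m. y l m - c * x l m)"
    have y': "alternating y'" unfolding y'_def by (rule alternating_diff[OF y x])
    have dep': "p dvd x l m * y' l n - x l n * y' l m" for l m n
      unfolding y'_def
    by (rule dvd_combine[OF dep(1)[of l m n] dvd_0_right, where r = "1" and s = 0])
      (simp add: algebra_simps)
    have y'uv: "p dvd y' u v" unfolding y'_def c_def
      by (rule dvd_combine[OF k dvd_0_right, where r = "- y u v" and s = 0])
        (simp add: algebra_simps)
    have y'u: "p dvd y' u m" for m
      by (rule dvd_combine3[OF dep'[of u v m] k y'uv, where r = "k" and s = "- y' u m" and t = "k * x u m"])
        (simp add: algebra_simps)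
    \<comment> \<open>Comparing the dependence at \<open>l\<close> with the one at \<open>u + l\<close>.\<close>
    have exch: "p dvd x u m * y' l n - x u n * y' l m" for l m n
    proof -
      have h: "p dvd (x l m + 1 * x u m) * (y' l n + 1 * y' u n) - (x l n + 1 * x u n) * (y' l m + 1 * y' u m)"
        using dep'[of "\<lambda>i. l i + 1 * u i" m n]
        by (simp only: alternating_simps[OF x] alternating_simps[OF y'])
      have h': "p dvd (x l m + x u m) * y' u n - (x l n + x u n) * y' u m"
        using y'u[of m] y'u[of n] by simp
      show ?thesis
        by (rule dvd_combine3[OF h dep'[of l m n] h', where r = "1" and s = "-1" and t = "-1"])
          (simp add: algebra_simps)
    qed
    have "p dvd y' v l" for l
          proof -
      have "p dvd x u v * y' v l" using exch[of v v l] alternating_simps(3)[OF y', of v] by simp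
      then show ?thesis using p dep(2) prime_dvd_multD by blast
    qed
    then have y'v: "p dvd y' l v" for l using alternating_skew[OF y', of l v] by simp
    have y'0: "p dvd y' l m" for l m
    proof -
      have "p dvd x u v * y' l m"
        by (rule dvd_combine[OF exch[where l = l and m = v and n = m] y'v[of l], where r = "1" and s = "x u m"])
          (simp add: algebra_simps)
      then show ?thesis using p dep(2) prime_dvd_multD by blast
    qed
    have bx: "p dvd b l m" if "p dvd x l m" for l m
    proof -
      have "p dvd y l m"
        by (rule dvd_combine[OF y'0[of l m] that, where r = 1 and s = c]) (simp add: y'_def)
      then show ?thesis using van that by blast
    qed
    show ?thesis
    proof (rule alternating_form_vanishing_with_one[OF p x b])
      show "p dvd b l m" if "p dvd x l m" for l m using that by (rule bx)
    next
      fix c assume "p dvd b l m - c * x l m" for l m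
      then show ?thesis using that[of c 0] by simp
    qed
  qed
qed

section \<open>Capability from cocycles\<close>

text \<open>Normalized 2-cocycles with values in the integers modulo \<open>m\<close> with trivial action.\<close>

definition cocycle_mod :: "('a, 'm) monoid_scheme \<Rightarrow> int \<Rightarrow> ('a \<Rightarrow> 'a \<Rightarrow> int) \<Rightarrow> bool" where
  "cocycle_mod G m f \<longleftrightarrow>
     (\<forall>h \<in> carrier G. [f \<one>\<^bsub>G\<^esub> h = 0] (mod m)) \<and>
     (\<forall>g \<in> carrier G. \<forall>h \<in> carrier G. \<forall>k \<in> carrier G.
        [f g h + f (g \<otimes>\<^bsub>G\<^esub> h) k = f h k + f g (h \<otimes>\<^bsub>G\<^esub> k)] (mod m))"

text \<open>The group \<open>E\<close> is the central extension of \<open>G\<close> by a product of cyclic groups of order \<open>m\<close>, one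
factor for each cocycle of the family.  Its kernel is central, and a central element of \<open>E\<close> lies over
an element \<open>z\<close> on which all cocycles are symmetric, so over \<open>\<one>\<close>.\<close>

lemma (in group) capable_if_cocycles_detect_center:
  fixes F :: "'i \<Rightarrow> 'a \<Rightarrow> 'a \<Rightarrow> int" and m :: int
  assumes m: "m > 0" and F: "\<And>i. cocycle_mod G m (F i)"
    and det: "\<And>z. z \<in> group_center G \<Longrightarrow> z \<noteq> \<one> \<Longrightarrow>
                \<exists>i. \<exists>h \<in> carrier G. \<not> [F i z h = F i h z] (mod m)"
  shows "capable G"
proof -
  define A where "A = {s. \<forall>i::'i. s i \<in> {0..<m}}"
  define E :: "('a \<times> ('i \<Rightarrow> int)) monoid" where
    "E = \<lparr>carrier = carrier G \<times> A,
          monoid.mult = (\<lambda>(g, s) (h, t). (g \<otimes> h, \<lambda>i. (s i + t i + F i g h) mod m)),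
          one = (\<one>, \<lambda>_. 0)\<rparr>"
  have carr: "carrier E = carrier G \<times> A" by (simp add: E_def)
  have mult: "(g, s) \<otimes>\<^bsub>E\<^esub> (h, t) = (g \<otimes> h, \<lambda>i. (s i + t i + F i g h) mod m)" for g s h t
    by (simp add: E_def)
  have one: "\<one>\<^bsub>E\<^esub> = (\<one>, \<lambda>_. 0)" by (simp add: E_def)
  have modA: "(\<lambda>i. r i mod m) \<in> A" for r using m by (simp add: A_def)
  have Amod: "s i mod m = s i" if "s \<in> A" for s i using that by (simp add: A_def)
  have zA: "(\<lambda>_. 0) \<in> A" using m by (simp add: A_def)
  have F1: "F i \<one> h mod m = 0" if "h \<in> carrier G" for i h
    using F[of i] that by (auto simp: cocycle_mod_def cong_def)
  have F2: "(F i g h + F i (g \<otimes> h) k) mod m = (F i h k + F i g (h \<otimes> k)) mod m"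
    if "g \<in> carrier G" "h \<in> carrier G" "k \<in> carrier G" for i g h k
    using F[of i] that by (auto simp: cocycle_mod_def cong_def)
  have E: "group E"
  proof (rule groupI)
    fix a b assume "a \<in> carrier E" "b \<in> carrier E"
    then show "a \<otimes>\<^bsub>E\<^esub> b \<in> carrier E" by (auto simp: carr mult modA)
  next
    show "\<one>\<^bsub>E\<^esub> \<in> carrier E" by (simp add: carr one zA)
  next
    fix a b c assume "a \<in> carrier E" "b \<in> carrier E" "c \<in> carrier E"
    then obtain g s h t k u where abc: "a = (g, s)" "b = (h, t)" "c = (k, u)"
      and G: "g \<in> carrier G" "h \<in> carrier G" "k \<in> carrier G" by (auto simp: carr)
    have mid: "(a + b mod m + c) mod m = (a + b + c) mod m" for a b c
      by (metis add.assoc add.commute mod_add_left_eq)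
    have "((s i + t i + F i g h) mod m + u i + F i (g \<otimes> h) k) mod m =
          (s i + (t i + u i + F i h k) mod m + F i g (h \<otimes> k)) mod m" for i
    proof -
      have "((s i + t i + F i g h) mod m + u i + F i (g \<otimes> h) k) mod m =
            ((s i + t i + u i) + (F i g h + F i (g \<otimes> h) k)) mod m"
        using mid[of 0 "s i + t i + F i g h" "u i + F i (g \<otimes> h) k"] by (simp add: algebra_simps)
      also have "\<dots> = ((s i + t i + u i) + (F i h k + F i g (h \<otimes> k))) mod m"
        using F2[OF G, of i] by (metis mod_add_right_eq)
      also have "\<dots> = (s i + (t i + u i + F i h k) mod m + F i g (h \<otimes> k)) mod m"
        unfolding mid by (simp add: algebra_simps)
      finally show ?thesis .
    qed
    then show "a \<otimes>\<^bsub>E\<^esub> b \<otimes>\<^bsub>E\<^esub> c = a \<otimes>\<^bsub>E\<^esub> (b \<otimes>\<^bsub>E\<^esub> c)"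
      using G by (simp add: abc mult m_assoc)
  next
    fix a assume "a \<in> carrier E"
    then obtain g s where a: "a = (g, s)" "g \<in> carrier G" "s \<in> A" by (auto simp: carr)
    have "(s i + F i \<one> g) mod m = s i" for i
      using F1[OF a(2), of i] Amod[OF a(3), of i] by (metis add.right_neutral mod_add_right_eq)
    then show "\<one>\<^bsub>E\<^esub> \<otimes>\<^bsub>E\<^esub> a = a" using a by (simp add: one mult)
    let ?b = "(inv g, \<lambda>i. (- s i - F i (inv g) g) mod m)"
    have "((- s i - F i (inv g) g) mod m + s i + F i (inv g) g) mod m = 0" for i
      by (simp only: add.assoc mod_add_left_eq) simp
    then have "?b \<otimes>\<^bsub>E\<^esub> a = \<one>\<^bsub>E\<^esub>" using a by (simp add: one mult)
    moreover have "?b \<in> carrier E" using a by (simp add: carr modA)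
    ultimately show "\<exists>b \<in> carrier E. b \<otimes>\<^bsub>E\<^esub> a = \<one>\<^bsub>E\<^esub>" by blast
  qed
  have "fst \<in> hom E G" by (rule homI) (auto simp: carr mult)
  then interpret fst: group_hom E G fst
    by (simp add: group_hom_def group_hom_axioms_def E is_group)
  have "fst ` carrier E = carrier G" using zA by (force simp: carr)
  then have "E Mod kernel E G fst \<cong> G" by (rule fst.FactGroup_iso)
  moreover have "kernel E G fst = group_center E"
  proof (intro equalityI subsetI)
    fix a assume "a \<in> kernel E G fst"
    then obtain s where s: "a = (\<one>, s)" "s \<in> A" by (auto simp: kernel_def carr)
    have "a \<otimes>\<^bsub>E\<^esub> b = b \<otimes>\<^bsub>E\<^esub> a" if "b \<in> carrier E" for b
    proof -
      obtain h t where b: "b = (h, t)" "h \<in> carrier G" using \<open>b \<in> carrier E\<close> by (auto simp: carr)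
      have "F i h \<one> mod m = 0" for i
      proof -
        have "(F i h \<one> + F i h \<one>) mod m = (F i \<one> \<one> + F i h \<one>) mod m"
          using F2[of h \<one> \<one> i] b by simp
        then have "[F i h \<one> = F i \<one> \<one>] (mod m)" using cong_add_rcancel unfolding cong_def by blast
        then show ?thesis using F1[of \<one> i] by (simp add: cong_def)
      qed
      then have "(s i + t i + F i \<one> h) mod m = (t i + s i + F i h \<one>) mod m" for i
        using F1[OF b(2), of i] by (metis add.commute mod_add_right_eq)
      then show ?thesis using b by (simp add: s mult)
    qed
    then show "a \<in> group_center E" using s by (simp add: group_center_def carr)
  next
    fix a assume a: "a \<in> group_center E"
    then obtain z s where z: "a = (z, s)" "z \<in> carrier G" "s \<in> A" by (auto simp: group_center_def carr)
    have comm: "(z, s) \<otimes>\<^bsub>E\<^esub> (h, \<lambda>_. 0) = (h, \<lambda>_. 0) \<otimes>\<^bsub>E\<^esub> (z, s)" if "h \<in> carrier G" for h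
      using a z that zA by (simp add: group_center_def carr)
    have "z \<otimes> h = h \<otimes> z" if "h \<in> carrier G" for h using comm[OF that] by (simp add: mult)
    then have zc: "z \<in> group_center G" using z by (simp add: group_center_def)
    have "[F i z h = F i h z] (mod m)" if "h \<in> carrier G" for i h
    proof -
      have "(s i + F i z h) mod m = (s i + F i h z) mod m"
        using comm[OF that] by (simp add: mult fun_eq_iff)
      then show ?thesis using cong_add_lcancel unfolding cong_def by blast
    qed
    then have "z = \<one>" using det[OF zc] by blast
    then show "a \<in> kernel E G fst" using z by (simp add: kernel_def carr)
  qed
  ultimately have "E Mod group_center E \<cong> G" by simp
  then have "G \<cong> E Mod group_center E"
    using normal.factorgroup_is_group[OF group.group_center_normal[OF E]] by (rule group.iso_sym[rotated])
  with is_group E show ?thesis by (rule capableI)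
qed

definition hom_mod :: "('a, 'm) monoid_scheme \<Rightarrow> int \<Rightarrow> ('a \<Rightarrow> int) \<Rightarrow> bool" where
  "hom_mod G m f \<longleftrightarrow>
     (\<forall>g \<in> carrier G. \<forall>h \<in> carrier G. [f (g \<otimes>\<^bsub>G\<^esub> h) = f g + f h] (mod m))"

lemma hom_modD:
  "hom_mod G m f \<Longrightarrow> g \<in> carrier G \<Longrightarrow> h \<in> carrier G \<Longrightarrow> [f (g \<otimes>\<^bsub>G\<^esub> h) = f g + f h] (mod m)"
  by (simp add: hom_mod_def)

lemma (in group) hom_mod_one:
  assumes "hom_mod G m f" shows "[f \<one> = 0] (mod m)"
proof -
  have "[f \<one> + 0 = f \<one> + f \<one>] (mod m)" using hom_modD[OF assms, of \<one> \<one>] by simp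
  then show ?thesis using cong_add_lcancel cong_sym by blast
qed

lemma (in group) hom_mod_kernel_subgroup:
  assumes f: "hom_mod G m f" shows "subgroup {g \<in> carrier G. [f g = 0] (mod m)} G"
proof
  fix g h assume "g \<in> {g \<in> carrier G. [f g = 0] (mod m)}" "h \<in> {g \<in> carrier G. [f g = 0] (mod m)}"
  then have gh: "g \<in> carrier G" "h \<in> carrier G" and *: "[f g = 0] (mod m)" "[f h = 0] (mod m)" by auto
  have 0: "[f g + f h = 0 + 0] (mod m)" by (rule cong_add[OF *])
  show "g \<otimes> h \<in> {g \<in> carrier G. [f g = 0] (mod m)}"
    using cong_trans[OF hom_modD[OF f gh] 0] gh by simp
next
  fix g assume "g \<in> {g \<in> carrier G. [f g = 0] (mod m)}"
  then have g: "g \<in> carrier G" and 0: "[f g = 0] (mod m)" by auto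
  have "[f g + f (inv g) = 0] (mod m)"
    using hom_modD[OF f g inv_closed[OF g]] hom_mod_one[OF f] g by (simp add: cong_def)
  moreover have "[f g + f (inv g) = 0 + f (inv g)] (mod m)" by (intro cong_add 0 cong_refl)
  ultimately show "inv g \<in> {g \<in> carrier G. [f g = 0] (mod m)}"
    using g by (simp add: cong_def)
qed (use hom_mod_one[OF f] in auto)

text \<open>The triple \<open>(l, u, c)\<close> is a homomorphism to the Heisenberg group.  An integer \<open>k\<close> acts on binary
quadratic forms, in coordinates, by \<open>(q\<^sub>0, q\<^sub>1, q\<^sub>2) \<mapsto> (q\<^sub>0, q\<^sub>1 + k q\<^sub>0, q\<^sub>2 + 2 k q\<^sub>1 + k\<^sup>2 q\<^sub>0)\<close>.  The
semidirect product for this action is a central extension of the Heisenberg group, with \<open>l = k\<close>,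
\<open>u = q\<^sub>0\<close>, \<open>c = 2 q\<^sub>1\<close>, and its multiplication in the coordinate \<open>q\<^sub>2\<close> is the cocycle.\<close>

lemma (in group) heisenberg_cocycle:
  assumes l: "hom_mod G m l" and u: "hom_mod G m u"
    and c: "\<And>g h. g \<in> carrier G \<Longrightarrow> h \<in> carrier G \<Longrightarrow> [c (g \<otimes> h) = c g + c h + 2 * (l g * u h)] (mod m)"
  shows "cocycle_mod G m (\<lambda>g h. l g * c h + (l g)\<^sup>2 * u h)"
  unfolding cocycle_mod_def
proof (intro conjI ballI)
  fix h assume "h \<in> carrier G"
  have "[l \<one> * c h + (l \<one>)\<^sup>2 * u h = 0 * c h + 0\<^sup>2 * u h] (mod m)"
    by (intro cong_add cong_mult cong_pow hom_mod_one[OF l] cong_refl)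
  then show "[l \<one> * c h + (l \<one>)\<^sup>2 * u h = 0] (mod m)" by simp
next
  fix g h k assume G: "g \<in> carrier G" "h \<in> carrier G" "k \<in> carrier G"
  have L: "[l (g \<otimes> h) = l g + l h] (mod m)" and U: "[u (h \<otimes> k) = u h + u k] (mod m)"
    using l u G by (auto simp: hom_mod_def)
  have "[l g * c h + (l g)\<^sup>2 * u h + (l (g \<otimes> h) * c k + (l (g \<otimes> h))\<^sup>2 * u k)
       = l g * c h + (l g)\<^sup>2 * u h + ((l g + l h) * c k + (l g + l h)\<^sup>2 * u k)] (mod m)"
    by (intro cong_add cong_mult cong_pow L cong_refl)
  also have "l g * c h + (l g)\<^sup>2 * u h + ((l g + l h) * c k + (l g + l h)\<^sup>2 * u k)
     = l h * c k + (l h)\<^sup>2 * u k + (l g * (c h + c k + 2 * (l h * u k)) + (l g)\<^sup>2 * (u h + u k))"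
    by (simp add: algebra_simps power2_eq_square)
  also have "[\<dots> = l h * c k + (l h)\<^sup>2 * u k + (l g * c (h \<otimes> k) + (l g)\<^sup>2 * u (h \<otimes> k))] (mod m)"
    by (intro cong_add cong_mult cong_pow cong_sym[OF U] cong_sym[OF c] G cong_refl)
  finally show "[l g * c h + (l g)\<^sup>2 * u h + (l (g \<otimes> h) * c k + (l (g \<otimes> h))\<^sup>2 * u k)
     = l h * c k + (l h)\<^sup>2 * u k + (l g * c (h \<otimes> k) + (l g)\<^sup>2 * u (h \<otimes> k))] (mod m)" .
qed

section \<open>Integral combinations in an abelian group\<close>

lemma card_le_two_subset:
  assumes "finite A" "card A \<le> 2"
  shows "\<exists>r s. A \<subseteq> {r, s}"
proof -
  consider "card A = 0" | "card A = 1" | "card A = 2" using assms(2) by linarith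
  then show ?thesis
  proof cases
    case 1
    then show ?thesis using assms(1) by simp
  next
    case 2
    then show ?thesis by (metis card_1_singletonE insert_absorb2 order_refl)
  next
    case 3
    then show ?thesis by (metis card_2_iff order_refl)
  qed
qed

context comm_group
begin

definition combination :: "('t \<Rightarrow> 'a) \<Rightarrow> 't set \<Rightarrow> ('t \<Rightarrow> int) \<Rightarrow> 'a" where
  "combination y T a = finprod G (\<lambda>t. y t [^] a t) T"

lemma combination_closed: "y \<in> T \<rightarrow> carrier G \<Longrightarrow> combination y T a \<in> carrier G"
  unfolding combination_def by (intro finprod_closed) auto

lemma combination_add:
  assumes "y \<in> T \<rightarrow> carrier G"
  shows "combination y T (\<lambda>t. a t + b t) = combination y T a \<otimes> combination y T b"
proof -
  have "combination y T (\<lambda>t. a t + b t) = finprod G (\<lambda>t. y t [^] a t \<otimes> y t [^] b t) T"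
    unfolding combination_def using assms by (intro finprod_cong') (auto simp: int_pow_mult Pi_iff)
  also have "\<dots> = combination y T a \<otimes> combination y T b"
    unfolding combination_def using assms by (intro finprod_multf) auto
  finally show ?thesis .
qed

lemma combination_scale:
  assumes "finite T" "y \<in> T \<rightarrow> carrier G"
  shows "combination y T (\<lambda>t. k * a t) = combination y T a [^] k"
  using assms
proof (induction T rule: finite_induct)
  case (insert t T)
  then show ?case
    by (simp add: combination_def Pi_iff int_pow_distrib int_pow_pow mult.commute)
qed (simp add: combination_def)

lemma combination_diff:
  assumes "finite T" "y \<in> T \<rightarrow> carrier G"
  shows "combination y T (\<lambda>t. a t - b t) = combination y T a \<otimes> inv (combination y T b)"
proof -
  have "combination y T (\<lambda>t. a t - b t) = combination y T (\<lambda>t. a t + (-1) * b t)" by simp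
  also have "\<dots> = combination y T a \<otimes> combination y T (\<lambda>t. (-1) * b t)"
    by (rule combination_add[OF assms(2)])
  also have "combination y T (\<lambda>t. (-1) * b t) = inv (combination y T b)"
    unfolding combination_scale[OF assms] using combination_closed[OF assms(2), of b]
    by (simp add: int_pow_neg)
  finally show ?thesis .
qed

lemma combination_unit:
  assumes "finite T" "y \<in> T \<rightarrow> carrier G" "t \<in> T"
  shows "combination y T (\<lambda>s. if s = t then 1 else 0) = y t"
proof -
  have "combination y T (\<lambda>s. if s = t then 1 else 0) = finprod G (\<lambda>s. if t = s then y s else \<one>) T"
    unfolding combination_def using assms by (intro finprod_cong') (auto simp: Pi_iff)
  also have "\<dots> = y t" using assms by (intro finprod_singleton) auto
  finally show ?thesis .
qed

lemma combination_in_subgroup: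
  assumes "subgroup H G" "finite T" "\<And>t. t \<in> T \<Longrightarrow> y t [^] a t \<in> H"
  shows "combination y T a \<in> H"
  using assms(2,3)
proof (induction T rule: finite_induct)
  case empty
  then show ?case using subgroup.one_closed[OF assms(1)] by (simp add: combination_def)
next
  case (insert t T)
  have "y s [^] a s \<in> carrier G" if "s \<in> insert t T" for s
    using insert.prems[OF that] subgroup.mem_carrier[OF assms(1)] by blast
  then show ?case
    using insert subgroup.m_closed[OF assms(1)] by (simp add: combination_def Pi_iff)
qed

lemma combination_trivial:
  assumes "y \<in> T \<rightarrow> carrier G" "\<And>t. t \<in> T \<Longrightarrow> y t [^] (p::nat) = \<one>" "\<And>t. t \<in> T \<Longrightarrow> int p dvd a t"
  shows "combination y T a = \<one>"
  unfolding combination_def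
proof (rule finprod_one_eqI)
  fix t assume t: "t \<in> T"
  then obtain k where k: "a t = int p * k" using assms(3) by (auto elim: dvdE)
  have "y t [^] (int p * k) = (y t [^] int p) [^] k"
    using assms(1) t by (simp add: int_pow_pow Pi_iff)
  then show "y t [^] a t = \<one>" using assms(2)[OF t] k by (simp add: int_pow_int)
qed

text \<open>In an abelian group the coordinates with respect to generators are integers, so that all elements
and relations are handled through coefficient vectors.\<close>

lemma generate_eq_combinations:
  assumes "finite T" "y \<in> T \<rightarrow> carrier G"
  shows "generate G (y ` T) = range (combination y T)"
proof
  have y: "y ` T \<subseteq> carrier G" using assms(2) by auto
  have s: "subgroup (generate G (y ` T)) G" by (rule generate_is_subgroup[OF y])
  show "range (combination y T) \<subseteq> generate G (y ` T)"
    using combination_in_subgroup[OF s assms(1)] subgroup_int_pow_closed[OF s] generate.incl[of _ "y ` T" G]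
    by blast
  have "subgroup (range (combination y T)) G"
  proof (rule subgroupI)
    show "range (combination y T) \<subseteq> carrier G" using combination_closed[OF assms(2)] by blast
    fix g assume "g \<in> range (combination y T)"
    then obtain a where a: "g = combination y T a" by blast
    then have "combination y T (\<lambda>t. (-1) * a t) = inv g"
      using combination_scale[OF assms, of "-1" a] combination_closed[OF assms(2), of a]
      by (simp add: int_pow_neg)
    then show "inv g \<in> range (combination y T)" by (metis rangeI)
    fix h assume "h \<in> range (combination y T)"
    then obtain b where "h = combination y T b" by blast
    then have "combination y T (\<lambda>t. a t + b t) = g \<otimes> h"
      using a combination_add[OF assms(2)] by simp
    then show "g \<otimes> h \<in> range (combination y T)" by (metis rangeI)
  qed auto
  moreover have "y ` T \<subseteq> range (combination y T)"
    using combination_unit[OF assms] by (metis image_subsetI rangeI)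
  ultimately show "generate G (y ` T) \<subseteq> range (combination y T)"
    by (rule generate_subgroup_incl[rotated])
qed

lemma combination_Plus:
  assumes "finite S" "finite T" "y \<in> S \<rightarrow> carrier G" "z \<in> T \<rightarrow> carrier G"
  shows "combination (case_sum y z) (S <+> T) a =
    combination y S (a \<circ> Inl) \<otimes> combination z T (a \<circ> Inr)"
proof -
  have "combination (case_sum y z) (S <+> T) a =
      finprod G (\<lambda>t. case_sum y z t [^] a t) (Inl ` S) \<otimes> finprod G (\<lambda>t. case_sum y z t [^] a t) (Inr ` T)"
    unfolding combination_def Plus_def using assms by (intro finprod_Un_disjoint) (auto simp: Pi_iff)
  also have "finprod G (\<lambda>t. case_sum y z t [^] a t) (Inl ` S) = combination y S (a \<circ> Inl)"
    using assms by (subst finprod_reindex) (auto simp: combination_def Pi_iff)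
  also have "finprod G (\<lambda>t. case_sum y z t [^] a t) (Inr ` T) = combination z T (a \<circ> Inr)"
    using assms by (subst finprod_reindex) (auto simp: combination_def Pi_iff)
  finally show ?thesis .
qed

text \<open>A group given by generators and relations maps to the integers modulo \<open>m\<close> as soon as the
values on the generators kill the relations; the value at \<open>g\<close> is computed from any
coefficient vector of \<open>g\<close>.\<close>

lemma hom_mod_extension:
  fixes m :: int
  assumes T: "finite T" "y \<in> T \<rightarrow> carrier G" and gen: "generate G (y ` T) = carrier G"
    and rel: "\<And>a. combination y T a = \<one> \<Longrightarrow> m dvd (\<Sum>t\<in>T. a t * v t)"
  obtains f where "hom_mod G m f" "\<And>a. [f (combination y T a) = (\<Sum>t\<in>T. a t * v t)] (mod m)"
proof -
  define w where "w a = (\<Sum>t\<in>T. a t * v t)" for a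
  define r where "r g = (SOME a. combination y T a = g)" for g
  define f where "f g = w (r g)" for g
  have r: "combination y T (r g) = g" if "g \<in> carrier G" for g
  proof -
    have "\<exists>a. combination y T a = g"
      using that generate_eq_combinations[OF T] gen by (metis imageE)
    then show ?thesis unfolding r_def by (rule someI_ex)
  qed
  have w: "[w a = w b] (mod m)" if "combination y T a = combination y T b" for a b
  proof -
    have "combination y T (\<lambda>t. a t - b t) = \<one>"
      using combination_diff[OF T, of a b] that combination_closed[OF T(2), of b] by simp
    then have "m dvd w (\<lambda>t. a t - b t)" unfolding w_def by (rule rel)
    also have "w (\<lambda>t. a t - b t) = w a - w b"
      by (simp add: w_def left_diff_distrib sum_subtractf)
    finally show ?thesis by (simp add: cong_iff_dvd_diff)
  qed
  have f: "[f (combination y T a) = w a] (mod m)" for a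
    unfolding f_def by (rule w) (simp add: r combination_closed[OF T(2)])
  have "hom_mod G m f" unfolding hom_mod_def
  proof (intro ballI)
    fix g h assume G: "g \<in> carrier G" "h \<in> carrier G"
    have "combination y T (\<lambda>t. r g t + r h t) = g \<otimes> h"
      using combination_add[OF T(2), of "r g" "r h"] r G by simp
    with f[of "\<lambda>t. r g t + r h t"] show "[f (g \<otimes> h) = f g + f h] (mod m)"
      by (simp add: f_def w_def distrib_right sum.distrib)
  qed
  then show ?thesis using f unfolding w_def by (rule that)
qed

lemma mem_subgroup_of_coprime_pow:
  assumes H: "subgroup H G" and g: "g \<in> carrier G" "g [^] p = \<one>" and p: "prime (p :: nat)"
    and k: "\<not> int p dvd k" "g [^] k \<in> H"
  shows "g \<in> H"
proof -
  have "coprime k (int p)" using p k(1) by (metis coprime_commute prime_imp_coprime prime_nat_int_transfer)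
  then obtain j where "[k * j = 1] (mod int p)" using cong_solve_coprime_int by blast
  then obtain i where i: "k * j = 1 + int p * i"
    by (metis cong_iff_lin cong_sym)
  have "(g [^] k) [^] j = g [^] (1 + int p * i)" using g by (simp add: int_pow_pow i)
  also have "\<dots> = g \<otimes> (g [^] p) [^] i"
    using g(1) by (simp add: int_pow_mult int_pow_pow flip: int_pow_int)
  also have "\<dots> = g" using g by simp
  finally show ?thesis using subgroup_int_pow_closed[OF H k(2)] by metis
qed

text \<open>Solving a relation for a generator whose coefficient is invertible modulo \<open>p\<close>.\<close>

lemma isolate_generator:
  assumes H: "subgroup H G" and T: "finite T" "y \<in> T \<rightarrow> carrier G" and q: "q \<in> T"
    and exp: "y q [^] p = \<one>" and p: "prime (p :: nat)" and a: "\<not> int p dvd a q"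
    and rel: "combination y T a \<in> H" and rest: "\<And>t. t \<in> T - {q} \<Longrightarrow> y t [^] a t \<in> H"
  shows "y q \<in> H"
proof -
  have c: "combination y (T - {q}) a \<in> H"
    by (rule combination_in_subgroup[OF H]) (use T rest in auto)
  have yq: "y q \<in> carrier G" using T q by blast
  have cl: "combination y (T - {q}) a \<in> carrier G" using c subgroup.mem_carrier[OF H] by blast
  have "combination y (insert q (T - {q})) a = y q [^] a q \<otimes> combination y (T - {q}) a"
    unfolding combination_def using T yq by (intro finprod_insert) auto
  then have "combination y T a = y q [^] a q \<otimes> combination y (T - {q}) a"
    using q by (simp add: insert_absorb)
  then have "y q [^] a q = combination y T a \<otimes> inv (combination y (T - {q}) a)"
    using yq cl by (simp add: m_assoc)
  then have "y q [^] a q \<in> H"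
    using rel c H by (simp add: subgroup.m_closed subgroup.m_inv_closed)
  then show ?thesis by (rule mem_subgroup_of_coprime_pow[OF H yq exp p a])
qed

text \<open>A minimal subfamily \<open>Q\<close> generating the same subgroup is independent, and at most two indices lie
outside it.  Expressing each of these generators through \<open>Q\<close> gives one relation; subtracting multiples
of these relations moves any relation into \<open>Q\<close>, where it is trivial modulo \<open>p\<close>.\<close>

lemma relations_spanned_by_two:
  assumes T: "finite T" "y \<in> T \<rightarrow> carrier G" and p: "prime (p :: nat)"
    and exp: "\<And>t. t \<in> T \<Longrightarrow> y t [^] p = \<one>"
    and large: "\<And>Q. Q \<subseteq> T \<Longrightarrow> generate G (y ` Q) = generate G (y ` T) \<Longrightarrow> card T \<le> card Q + 2"
  obtains u v where "combination y T u = \<one>" "combination y T v = \<one>"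
    "\<And>a. combination y T a = \<one> \<Longrightarrow> \<exists>c d. \<forall>t \<in> T. int p dvd a t - c * u t - d * v t"
proof -
  define spans where "spans Q \<longleftrightarrow> Q \<subseteq> T \<and> generate G (y ` Q) = generate G (y ` T)" for Q
  have "spans T" by (simp add: spans_def)
  from ex_has_least_nat[of spans, OF this, of card]
  obtain Q where "spans Q" and min': "\<And>Q'. spans Q' \<Longrightarrow> card Q \<le> card Q'" by blast
  then have Q: "Q \<subseteq> T" "generate G (y ` Q) = generate G (y ` T)" by (auto simp: spans_def)
  have min: "card Q \<le> card Q'" if "Q' \<subseteq> T" "generate G (y ` Q') = generate G (y ` T)" for Q'
    using min'[of Q'] that by (simp add: spans_def)
  have fQ: "finite Q" using Q(1) T(1) finite_subset by blast
  have yT: "y ` T \<subseteq> carrier G" using T(2) by auto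
  have indep: "int p dvd a q" if a: "combination y T a = \<one>" "\<And>t. t \<in> T - Q \<Longrightarrow> a t = 0" and q: "q \<in> T" for a q
  proof (rule ccontr)
    assume n: "\<not> int p dvd a q"
    then have qQ: "q \<in> Q" using a(2) q by fastforce
    define H where "H = generate G (y ` (Q - {q}))"
    have H: "subgroup H G" unfolding H_def by (rule generate_is_subgroup) (use yT Q in auto)
    have "y t [^] a t \<in> H" if "t \<in> T - {q}" for t
    proof (cases "t \<in> Q")
      case True
      then have "y t \<in> H" unfolding H_def using that by (intro generate.incl) auto
      then show ?thesis by (rule subgroup_int_pow_closed[OF H])
    qed (use a(2) that subgroup.one_closed[OF H] in auto)
    then have "y q \<in> H"
      using isolate_generator[where y = y and q = q and a = a, OF H T q exp[OF q] p n] a(1) subgroup.one_closed[OF H] by simp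
    moreover have "y t \<in> H" if "t \<in> Q - {q}" for t
      unfolding H_def using that by (intro generate.incl imageI)
    ultimately have "y ` Q \<subseteq> H" by blast
    then have "generate G (y ` Q) \<subseteq> H" by (rule generate_subgroup_incl[OF _ H])
    moreover have "H \<subseteq> generate G (y ` Q)" unfolding H_def by (rule mono_generate) auto
    ultimately have "card Q \<le> card (Q - {q})" using min[of "Q - {q}"] Q by (auto simp: H_def)
    then show False using fQ qQ by (metis card_Diff1_less not_le)
  qed
  \<comment> \<open>The relation expressing \<open>y r\<close> through \<open>Q\<close>.\<close>
  define good where "good r u \<longleftrightarrow> combination y T u = \<one> \<and> u r = 1 \<and> (\<forall>t \<in> T - Q - {r}. u t = 0)" for r u
  have good: "\<exists>u. good r u" if r: "r \<in> T - Q" for r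
  proof -
    have yQ: "y \<in> Q \<rightarrow> carrier G" using T(2) Q(1) by auto
    have "y r \<in> generate G (y ` Q)" unfolding Q(2) using r by (intro generate.incl) auto
    then obtain b where b: "y r = combination y Q b" using generate_eq_combinations[OF fQ yQ] by auto
    define b' where "b' t = (if t \<in> Q then b t else 0)" for t
    have "combination y Q b = combination y T b'"
      unfolding combination_def b'_def
      by (rule finprod_mono_neutral_cong_left) (use T Q in \<open>auto simp: Pi_iff\<close>)
    then have e: "y r = combination y T b'" using b by simp
    have yr: "y r \<in> carrier G" using r T(2) by auto
    let ?u = "\<lambda>t. (if t = r then 1 else 0) - b' t"
    have "combination y T ?u = y r \<otimes> inv (y r)"
      using combination_diff[OF T, of "\<lambda>t. if t = r then 1 else 0" b']
        combination_unit[OF T, of r] r e by simp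
    then have "good r ?u" using r yr by (auto simp: good_def b'_def)
    then show ?thesis by blast
  qed
  have "card (T - Q) \<le> 2" using large[OF Q] card_Diff_subset[OF fQ Q(1)] by simp
  then obtain r s where rs: "T - Q \<subseteq> {r, s}"
    using card_le_two_subset[of "T - Q"] T(1) by (metis finite_Diff)
  \<comment> \<open>When fewer than two indices lie outside \<open>Q\<close>, the zero relation fills in; \<open>s \<noteq> r\<close> keeps a single
outer index from being subtracted twice.\<close>
  define u where "u = (if r \<in> T - Q then SOME u. good r u else (\<lambda>_. 0))"
  define v where "v = (if s \<in> T - Q \<and> s \<noteq> r then SOME v. good s v else (\<lambda>_. 0))"
  have u: "good r u" if "r \<in> T - Q" using someI_ex[OF good[OF that]] that by (simp add: u_def)
  have v: "good s v" if "s \<in> T - Q" "s \<noteq> r" using someI_ex[OF good[OF that(1)]] that by (simp add: v_def)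
  have zero: "combination y T (\<lambda>_. 0) = \<one>" by (simp add: combination_def)
  have ru: "combination y T u = \<one>"
    using u zero by (cases "r \<in> T - Q") (auto simp: good_def u_def)
  have rv: "combination y T v = \<one>"
    using v zero by (cases "s \<in> T - Q \<and> s \<noteq> r") (auto simp: good_def v_def)
  show ?thesis
  proof (rule that[OF ru rv])
    fix a assume a: "combination y T a = \<one>"
    define c d where "c = a r" and "d = (if s = r then 0 else a s)"
    let ?a = "\<lambda>t. a t + ((- c) * u t + (- d) * v t)"
    have "combination y T ?a = \<one>"
      using combination_add[OF T(2), of a "\<lambda>t. (- c) * u t + (- d) * v t"]
        combination_add[OF T(2), of "\<lambda>t. (- c) * u t" "\<lambda>t. (- d) * v t"]
        combination_scale[OF T, of "-c" u] combination_scale[OF T, of "-d" v] a ru rv by simp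
    moreover have "?a t = 0" if t: "t \<in> T - Q" for t
      using t rs u v by (auto simp: good_def c_def d_def u_def v_def split: if_splits)
    ultimately have "\<forall>t\<in>T. int p dvd ?a t" using indep by blast
    then show "\<exists>c d. \<forall>t \<in> T. int p dvd a t - c * u t - d * v t"
      by (intro exI[of _ c] exI[of _ d]) (simp add: algebra_simps)
  qed
qed
end

section \<open>Groups of class two and odd prime exponent as abelian groups\<close>

definition commutator :: "('a, 'm) monoid_scheme \<Rightarrow> 'a \<Rightarrow> 'a \<Rightarrow> 'a" where
  "commutator G g h = g \<otimes>\<^bsub>G\<^esub> h \<otimes>\<^bsub>G\<^esub> inv\<^bsub>G\<^esub> g \<otimes>\<^bsub>G\<^esub> inv\<^bsub>G\<^esub> h"

text \<open>The additive group of the Lie ring that the Baer correspondence attaches to \<open>G\<close>: since \<open>(p + 1) div 2\<close>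
inverts \<open>2\<close> modulo \<open>p\<close>, this is the product \<open>g h [h,g]\<^sup>1\<^sup>/\<^sup>2\<close>.\<close>

definition baer_group :: "('a, 'm) monoid_scheme \<Rightarrow> nat \<Rightarrow> 'a monoid" where
  "baer_group G p =
     \<lparr>carrier = carrier G,
      monoid.mult = (\<lambda>g h. g \<otimes>\<^bsub>G\<^esub> h \<otimes>\<^bsub>G\<^esub> commutator G h g [^]\<^bsub>G\<^esub> (Suc p div 2)),
      one = \<one>\<^bsub>G\<^esub>\<rparr>"

locale class_two_exponent = group +
  fixes p :: nat
  assumes prime_p: "prime p" and odd_p: "odd p"
    and exponent: "g \<in> carrier G \<Longrightarrow> g [^] p = \<one>"
    and commutator_central: "g \<in> carrier G \<Longrightarrow> h \<in> carrier G \<Longrightarrow> commutator G g h \<in> group_center G"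
begin

abbreviation "C \<equiv> commutator G"
abbreviation "Z \<equiv> group_center G"

lemma center_closed: "z \<in> Z \<Longrightarrow> z \<in> carrier G"
  by (simp add: group_center_def)

lemma center_comm: "z \<in> Z \<Longrightarrow> g \<in> carrier G \<Longrightarrow> g \<otimes> z = z \<otimes> g"
  by (simp add: group_center_def)

lemma center_left_comm:
  assumes "z \<in> Z" "g \<in> carrier G" "h \<in> carrier G" shows "g \<otimes> (z \<otimes> h) = z \<otimes> (g \<otimes> h)"
  using assms center_comm[OF assms(1,2)] center_closed[OF assms(1)] by (metis m_assoc)

lemma commutator_closed: "g \<in> carrier G \<Longrightarrow> h \<in> carrier G \<Longrightarrow> C g h \<in> carrier G"
  by (simp add: commutator_def)

lemma mult_swap: "g \<in> carrier G \<Longrightarrow> h \<in> carrier G \<Longrightarrow> g \<otimes> h = C g h \<otimes> (h \<otimes> g)"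
  by (simp add: commutator_def m_assoc inv_solve_left')

lemma commutator_eqI:
  assumes "g \<in> carrier G" "h \<in> carrier G" "z \<in> carrier G" "g \<otimes> h = z \<otimes> (h \<otimes> g)"
  shows "C g h = z"
  using assms mult_swap[of g h] commutator_closed[of g h] by (metis m_closed right_cancel)

lemma commutator_mult_left:
  assumes "g \<in> carrier G" "h \<in> carrier G" "k \<in> carrier G"
  shows "C (g \<otimes> h) k = C g k \<otimes> C h k"
proof (rule commutator_eqI)
  have "g \<otimes> h \<otimes> k = g \<otimes> (C h k \<otimes> (k \<otimes> h))"
    using assms mult_swap[of h k] by (simp add: m_assoc)
  also have "\<dots> = C h k \<otimes> (g \<otimes> k \<otimes> h)"
    using assms center_left_comm[OF commutator_central[of h k], of g "k \<otimes> h"] by (simp add: m_assoc)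
  also have "g \<otimes> k \<otimes> h = C g k \<otimes> (k \<otimes> g) \<otimes> h"
    using assms mult_swap[of g k] by simp
  also have "C h k \<otimes> (C g k \<otimes> (k \<otimes> g) \<otimes> h) = C g k \<otimes> C h k \<otimes> (k \<otimes> (g \<otimes> h))"
    using assms commutator_central[of h k] commutator_closed center_comm[of "C h k" "C g k"]
    by (simp add: m_assoc[symmetric])
  finally show "g \<otimes> h \<otimes> k = C g k \<otimes> C h k \<otimes> (k \<otimes> (g \<otimes> h))" .
qed (use assms commutator_closed in auto)

lemma commutator_swap:
  assumes "g \<in> carrier G" "h \<in> carrier G"
  shows "C h g = inv (C g h)"
proof (rule commutator_eqI)
  show "h \<otimes> g = inv (C g h) \<otimes> (g \<otimes> h)"
    using assms commutator_closed[of g h] by (simp add: mult_swap[of g h] m_assoc[symmetric])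
qed (use assms commutator_closed in auto)

lemma commutator_mult_right:
  assumes "g \<in> carrier G" "h \<in> carrier G" "k \<in> carrier G"
  shows "C k (g \<otimes> h) = C k g \<otimes> C k h"
  using assms commutator_swap[of "g \<otimes> h" k] commutator_swap[of g k] commutator_swap[of h k]
    commutator_closed commutator_mult_left[of g h k] commutator_central center_comm
  by (simp add: inv_mult_group)
   (metis assms commutator_closed commutator_central center_comm)

lemma commutator_self: "g \<in> carrier G \<Longrightarrow> C g g = \<one>"
  by (rule commutator_eqI) auto

lemma commutator_one: "g \<in> carrier G \<Longrightarrow> C g \<one> = \<one>" "g \<in> carrier G \<Longrightarrow> C \<one> g = \<one>"
  by (simp_all add: commutator_def)

lemma commutator_center:
  assumes "z \<in> Z" "g \<in> carrier G" shows "C z g = \<one>" "C g z = \<one>"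
  using assms center_closed[OF assms(1)] center_comm[OF assms]
  by (auto intro!: commutator_eqI)

abbreviation "L \<equiv> baer_group G p"
abbreviation "half_p \<equiv> Suc p div 2"

lemma baer_carrier [simp]: "carrier L = carrier G" and baer_one [simp]: "\<one>\<^bsub>L\<^esub> = \<one>"
  and baer_mult: "g \<otimes>\<^bsub>L\<^esub> h = g \<otimes> h \<otimes> C h g [^] half_p"
  by (simp_all add: baer_group_def)

lemma pow_center: "z \<in> Z \<Longrightarrow> z [^] (k::nat) \<in> Z"
  by (induction k) (simp_all add: subgroup.one_closed[OF group_center_subgroup] subgroup.m_closed[OF group_center_subgroup])

lemma baer_mult_center:
  assumes "z \<in> Z" "g \<in> carrier G" shows "g \<otimes>\<^bsub>L\<^esub> z = g \<otimes> z" "z \<otimes>\<^bsub>L\<^esub> g = z \<otimes> g"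
  using assms by (simp_all add: baer_mult commutator_center center_closed)

lemma pow_half_twice: "g \<in> carrier G \<Longrightarrow> g [^] half_p \<otimes> g [^] half_p = g"
proof -
  assume g: "g \<in> carrier G"
  have "half_p + half_p = p + 1" using odd_p by presburger
  then show ?thesis using g exponent[OF g] by (simp add: nat_pow_mult)
qed

lemma mult_inv_pow_half: "g \<in> carrier G \<Longrightarrow> g \<otimes> inv g [^] half_p = g [^] half_p"
  using pow_half_twice[of g] by (metis inv_closed inv_solve_right nat_pow_closed nat_pow_inv)

lemma pow_mult_center:
  assumes "z \<in> Z" "g \<in> carrier G" shows "(z \<otimes> g) [^] (k::nat) = z [^] k \<otimes> g [^] k"
  using assms by (intro pow_mult_distrib) (auto simp: center_comm[symmetric] center_closed)

lemma baer_comm: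
  assumes "g \<in> carrier G" "h \<in> carrier G" shows "g \<otimes>\<^bsub>L\<^esub> h = h \<otimes>\<^bsub>L\<^esub> g"
proof -
  have c: "C g h \<in> carrier G" "C g h \<in> Z" using assms commutator_closed commutator_central by auto
  have "g \<otimes>\<^bsub>L\<^esub> h = C g h \<otimes> (h \<otimes> g) \<otimes> inv (C g h) [^] half_p"
    using assms by (simp add: baer_mult commutator_swap[of g h] mult_swap[of g h])
  also have "\<dots> = h \<otimes> g \<otimes> (C g h \<otimes> inv (C g h) [^] half_p)"
    using assms c center_comm[of "C g h" "h \<otimes> g"] by (simp add: m_assoc[symmetric])
  also have "\<dots> = h \<otimes>\<^bsub>L\<^esub> g" using assms by (simp only: mult_inv_pow_half[OF c(1)] baer_mult)
  finally show ?thesis .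
qed

lemma baer_assoc:
  assumes G: "g \<in> carrier G" "h \<in> carrier G" "k \<in> carrier G"
  shows "g \<otimes>\<^bsub>L\<^esub> h \<otimes>\<^bsub>L\<^esub> k = g \<otimes>\<^bsub>L\<^esub> (h \<otimes>\<^bsub>L\<^esub> k)"
proof -
  define a b c where "a = C h g [^] half_p" and "b = C k g [^] half_p" and "c = C k h [^] half_p"
  have Z: "a \<in> Z" "b \<in> Z" "c \<in> Z" using G by (auto simp: a_def b_def c_def pow_center commutator_central)
  then have cl: "a \<in> carrier G" "b \<in> carrier G" "c \<in> carrier G" by (auto simp: center_closed)
  have "C k (g \<otimes> h \<otimes> a) = C k g \<otimes> C k h" "C (h \<otimes> k \<otimes> c) g = C h g \<otimes> C k g"
    using G Z cl by (simp_all add: commutator_mult_left commutator_mult_right commutator_center commutator_closed)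
  then have 1: "C k (g \<otimes> h \<otimes> a) [^] half_p = b \<otimes> c" "C (h \<otimes> k \<otimes> c) g [^] half_p = a \<otimes> b"
    using G by (simp_all add: pow_mult_center commutator_closed commutator_central a_def b_def c_def)
  have "g \<otimes>\<^bsub>L\<^esub> h \<otimes>\<^bsub>L\<^esub> k = g \<otimes> h \<otimes> a \<otimes> k \<otimes> (b \<otimes> c)"
    using 1(1) by (simp add: baer_mult a_def)
  also have "\<dots> = g \<otimes> (h \<otimes> k \<otimes> c) \<otimes> (a \<otimes> b)"
    using G Z cl by (simp add: m_assoc center_comm center_left_comm)
  also have "\<dots> = g \<otimes>\<^bsub>L\<^esub> (h \<otimes>\<^bsub>L\<^esub> k)"
    using 1(2) by (simp add: baer_mult c_def)
  finally show ?thesis .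
qed

lemma baer_comm_group: "comm_group L"
proof (rule comm_groupI)
  fix g assume "g \<in> carrier L"
  then show "\<exists>h\<in>carrier L. h \<otimes>\<^bsub>L\<^esub> g = \<one>\<^bsub>L\<^esub>"
    by (intro bexI[of _ "inv g"]) (auto simp: baer_mult commutator_def m_assoc)
next
  fix g h assume "g \<in> carrier L" "h \<in> carrier L"
  then show "g \<otimes>\<^bsub>L\<^esub> h \<in> carrier L" by (simp add: baer_mult commutator_closed)
next
  fix g assume "g \<in> carrier L"
  then show "\<one>\<^bsub>L\<^esub> \<otimes>\<^bsub>L\<^esub> g = g" by (simp add: baer_mult commutator_one)
next
  fix g h assume "g \<in> carrier L" "h \<in> carrier L"
  then show "g \<otimes>\<^bsub>L\<^esub> h = h \<otimes>\<^bsub>L\<^esub> g" by (simp only: baer_comm baer_carrier)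
qed (simp_all add: baer_assoc)

sublocale baer: comm_group "baer_group G p"
  rewrites "carrier (baer_group G p) = carrier G" and "\<one>\<^bsub>baer_group G p\<^esub> = \<one>"
  by (rule baer_comm_group) simp_all

lemma commutator_pow_self: "g \<in> carrier G \<Longrightarrow> C g (g [^] (k::nat)) = \<one>"
  by (rule commutator_eqI) (simp_all add: nat_pow_Suc2[symmetric])

lemma baer_pow: "g \<in> carrier G \<Longrightarrow> g [^]\<^bsub>L\<^esub> (k::nat) = g [^] k"
  by (induction k) (simp_all add: baer_mult commutator_pow_self)

lemma baer_exponent: "g \<in> carrier G \<Longrightarrow> g [^]\<^bsub>L\<^esub> p = \<one>"
  by (simp add: baer_pow exponent)

lemma baer_inv:
  assumes "g \<in> carrier G" shows "inv\<^bsub>L\<^esub> g = inv g"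
proof -
  have "C g (inv g) = \<one>" using assms by (simp add: commutator_def)
  then have "inv g \<otimes>\<^bsub>L\<^esub> g = \<one>" using assms by (simp add: baer_mult)
  then show ?thesis using assms by (intro baer.inv_equality) auto
qed

abbreviation "D \<equiv> derived G (carrier G)"

lemma commutator_in_derived: "g \<in> carrier G \<Longrightarrow> h \<in> carrier G \<Longrightarrow> C g h \<in> D"
  unfolding derived_def commutator_def by (rule generate.incl) blast

lemma derived_in_subgroup:
  assumes "subgroup S G" and "\<And>g h. g \<in> carrier G \<Longrightarrow> h \<in> carrier G \<Longrightarrow> C g h \<in> S"
  shows "D \<subseteq> S"
  unfolding derived_def
  by (rule generate_subgroup_incl) (use assms in \<open>auto simp: commutator_def\<close>)

lemma derived_subgroup: "subgroup D G"
  by (rule derived_is_subgroup) simp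

lemma derived_subset_center: "D \<subseteq> Z"
  by (rule derived_in_subgroup[OF group_center_subgroup]) (rule commutator_central)

lemma commutator_subgroup:
  assumes S: "subgroup S G" and h: "h \<in> carrier G"
  shows "subgroup {g \<in> carrier G. C g h \<in> S} G"
proof
  fix g k assume "g \<in> {g \<in> carrier G. C g h \<in> S}" "k \<in> {g \<in> carrier G. C g h \<in> S}"
  then show "g \<otimes> k \<in> {g \<in> carrier G. C g h \<in> S}"
    using h subgroup.m_closed[OF S] by (simp add: commutator_mult_left)
next
  fix g assume g: "g \<in> {g \<in> carrier G. C g h \<in> S}"
  then have "C (inv g) h \<otimes> C g h = \<one>"
    using h commutator_mult_left[of "inv g" g h] by (simp add: commutator_one)
  then have "C (inv g) h = inv (C g h)"
    using g h by (intro inv_equality[symmetric]) (auto simp: commutator_closed)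
  then show "inv g \<in> {g \<in> carrier G. C g h \<in> S}"
    using g subgroup.m_inv_closed[OF S] by simp
qed (use h subgroup.one_closed[OF S] in \<open>auto simp: commutator_one\<close>)

text \<open>An induction over generators in two arguments at once, for relations such as "\<open>C g h\<close> lies in a
subgroup" that are bilinear and symmetric; symmetry saves half of the closure conditions.\<close>

lemma generate_induct_symmetric:
  assumes A: "A \<subseteq> carrier G" "generate G A = carrier G"
    and base: "\<And>g h. g \<in> A \<Longrightarrow> h \<in> A \<Longrightarrow> R g h"
    and sub: "\<And>h. h \<in> carrier G \<Longrightarrow> subgroup {g \<in> carrier G. R g h} G"
    and sym: "\<And>g h. g \<in> carrier G \<Longrightarrow> h \<in> carrier G \<Longrightarrow> R g h \<Longrightarrow> R h g"
    and g: "g \<in> carrier G" and h: "h \<in> carrier G"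
  shows "R g h"
proof -
  have all: "R g h" if "h \<in> carrier G" "\<And>a. a \<in> A \<Longrightarrow> R a h" "g \<in> carrier G" for g h
  proof -
    have "A \<subseteq> {g \<in> carrier G. R g h}" using A(1) that(2) by blast
    then have "generate G A \<subseteq> {g \<in> carrier G. R g h}"
      by (rule generate_subgroup_incl) (rule sub[OF that(1)])
    then show ?thesis using A(2) that(3) by blast
  qed
  show ?thesis
  proof (rule all[OF h _ g])
    fix a assume a: "a \<in> A"
    then have ac: "a \<in> carrier G" using A(1) by blast
    have "R h a" by (rule all[OF ac base[OF _ a] h])
    then show "R a h" by (rule sym[OF h ac])
  qed
qed

lemma derived_in_subgroup_if_generators:
  assumes A: "A \<subseteq> carrier G" "generate G A = carrier G" and S: "subgroup S G"
    and base: "\<And>g h. g \<in> A \<Longrightarrow> h \<in> A \<Longrightarrow> C g h \<in> S"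
  shows "D \<subseteq> S"
proof (rule derived_in_subgroup[OF S])
  fix g h assume "g \<in> carrier G" "h \<in> carrier G"
  then show "C g h \<in> S"
  proof (rule generate_induct_symmetric[where R = "\<lambda>g h. C g h \<in> S", OF A, rotated 3])
    show "C g h \<in> S" if "g \<in> A" "h \<in> A" for g h using that by (rule base)
    show "subgroup {g \<in> carrier G. C g h \<in> S} G" if "h \<in> carrier G" for h
      using S that by (rule commutator_subgroup)
    show "C h g \<in> S" if "g \<in> carrier G" "h \<in> carrier G" "C g h \<in> S" for g h
      using that commutator_swap[of g h] subgroup.m_inv_closed[OF S] by simp
  qed
qed

lemma baer_generate_center:
  assumes "A \<subseteq> Z" shows "generate L A = generate G A"
proof -
  have gZ: "generate G A \<subseteq> Z" by (rule generate_subgroup_incl[OF assms group_center_subgroup])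
  show ?thesis
  proof
    show "generate L A \<subseteq> generate G A"
    proof
      fix g assume "g \<in> generate L A"
      then show "g \<in> generate G A"
      proof (induction rule: generate.induct)
        case (inv h)
        then have "h \<in> carrier G" using assms center_closed by blast
        then show ?case using inv by (simp add: baer_inv generate.inv)
      next
        case (eng g h)
        then have "g \<otimes>\<^bsub>L\<^esub> h = g \<otimes> h" using gZ by (intro baer_mult_center center_closed) auto
        with eng show ?case by (simp add: generate.eng)
      qed (simp_all add: generate.incl generate.one)
    qed
    show "generate G A \<subseteq> generate L A"
    proof
      fix g assume "g \<in> generate G A"
      then show "g \<in> generate L A"
      proof (induction rule: generate.induct)
        case one
        then show ?case using generate.one[of L A] by simp
      next
        case (inv h)
        then have "h \<in> carrier G" using assms center_closed by blast
        then show ?case using generate.inv[OF inv, of L] by (simp add: baer_inv)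
      next
        case (eng g h)
        then have "g \<otimes>\<^bsub>L\<^esub> h = g \<otimes> h" using gZ by (intro baer_mult_center center_closed) auto
        with eng show ?case by (metis generate.eng)
      qed (simp_all add: generate.incl generate.one)
    qed
  qed
qed

text \<open>The group product is recovered from the abelian one by a correction in the derived subgroup.  Hence both
products have the same subgroups above the derived subgroup, and a homomorphism of the
abelian group that vanishes on commutators is a homomorphism of \<open>G\<close>.\<close>

lemma mult_eq_baer:
  assumes "g \<in> carrier G" "h \<in> carrier G"
  shows "g \<otimes> h = g \<otimes>\<^bsub>L\<^esub> h \<otimes>\<^bsub>L\<^esub> C g h [^] half_p"
proof -
  have c: "C g h \<in> carrier G" "C g h [^] half_p \<in> Z"
    using assms by (auto simp: commutator_closed commutator_central pow_center)
  have "g \<otimes>\<^bsub>L\<^esub> h \<otimes>\<^bsub>L\<^esub> C g h [^] half_p = g \<otimes> h \<otimes> inv (C g h) [^] half_p \<otimes> C g h [^] half_p"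
    using assms c by (subst baer_mult_center(1)) (auto simp: baer_mult commutator_swap[of g h])
  also have "inv (C g h) [^] half_p = inv (C g h [^] half_p)" using c by (simp add: nat_pow_inv)
  finally show ?thesis using assms c by (simp add: m_assoc)
qed

lemma derived_pow: "z \<in> D \<Longrightarrow> z [^] (k::nat) \<in> D"
  by (induction k) (simp_all add: subgroup.one_closed[OF derived_subgroup] subgroup.m_closed[OF derived_subgroup])

lemma subgroup_baer_iff:
  assumes "D \<subseteq> S" shows "subgroup S L \<longleftrightarrow> subgroup S G"
proof -
  have pow: "C g h [^] half_p \<in> S" if "g \<in> carrier G" "h \<in> carrier G" for g h
    using derived_pow[OF commutator_in_derived[OF that], of half_p] assms by blast
  show ?thesis
  proof
    assume S: "subgroup S L"
    then have Sc: "g \<in> carrier G" if "g \<in> S" for g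
      using that subgroup.mem_carrier[OF S] by simp
    show "subgroup S G"
    proof
      fix g h assume gh: "g \<in> S" "h \<in> S"
      show "g \<otimes> h \<in> S"
        unfolding mult_eq_baer[OF Sc[OF gh(1)] Sc[OF gh(2)]]
        by (intro subgroup.m_closed[OF S] gh pow Sc)
    next
      fix g assume g: "g \<in> S"
      show "inv g \<in> S"
        using subgroup.m_inv_closed[OF S g] unfolding baer_inv[OF Sc[OF g]] .
    next
      show "S \<subseteq> carrier G" using Sc by blast
      show "\<one> \<in> S" using subgroup.one_closed[OF S] by simp
    qed
  next
    assume S: "subgroup S G"
    then have Sc: "g \<in> carrier G" if "g \<in> S" for g
      using that by (rule subgroup.mem_carrier)
    show "subgroup S L"
    proof
      fix g h assume gh: "g \<in> S" "h \<in> S"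
      show "g \<otimes>\<^bsub>L\<^esub> h \<in> S"
        unfolding baer_mult by (intro subgroup.m_closed[OF S] gh pow Sc)
    next
      fix g assume g: "g \<in> S"
      show "inv\<^bsub>L\<^esub> g \<in> S"
        using subgroup.m_inv_closed[OF S g] unfolding baer_inv[OF Sc[OF g]] .
    next
      show "S \<subseteq> carrier L" using Sc by auto
      show "\<one>\<^bsub>L\<^esub> \<in> S" using subgroup.one_closed[OF S] by simp
    qed
  qed
qed

end

section \<open>Presentations, maps to the Heisenberg group, and capability\<close>

definition index_pairs :: "nat \<Rightarrow> (nat \<times> nat) set" where
  "index_pairs n = {(i, j). 1 \<le> i \<and> i < j \<and> j \<le> n}"

lemma index_pairs_Suc: "index_pairs (Suc n) = index_pairs n \<union> (\<lambda>i. (i, Suc n)) ` {1..n}"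
  by (auto simp: index_pairs_def)

lemma finite_index_pairs [simp]: "finite (index_pairs n)"
proof (induction n)
  case 0
  have "index_pairs 0 = {}" by (auto simp: index_pairs_def)
  then show ?case by simp
qed (simp add: index_pairs_Suc)

lemma card_index_pairs: "card (index_pairs n) = n choose 2"
proof (induction n)
  case 0
  have "index_pairs 0 = {}" by (auto simp: index_pairs_def)
  then show ?case by simp
next
  case (Suc n)
  have "card (index_pairs (Suc n)) = card (index_pairs n) + card ((\<lambda>i. (i, Suc n)) ` {1..n})"
    unfolding index_pairs_Suc by (rule card_Un_disjoint) (simp, simp, auto simp: index_pairs_def)
  also have "card ((\<lambda>i. (i, Suc n)) ` {1..n}) = n" by (subst card_image) (auto simp: inj_on_def)
  finally show ?case using Suc by (simp add: numeral_2_eq_2)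
qed

text \<open>The pairing of the bivector with coordinates \<open>b\<close> with the decomposable form \<open>l \<and> m\<close>.\<close>

definition wedge_form :: "nat \<Rightarrow> (nat \<times> nat \<Rightarrow> int) \<Rightarrow> (nat \<Rightarrow> int) \<Rightarrow> (nat \<Rightarrow> int) \<Rightarrow> int" where
  "wedge_form n b l m = (\<Sum>(i, j)\<in>index_pairs n. b (i, j) * (l i * m j - l j * m i))"

lemma alternating_wedge_form: "alternating (wedge_form n b)"
  unfolding alternating_def wedge_form_def
  by (auto simp: sum_distrib_left sum.distrib[symmetric] sum_negf[symmetric] algebra_simps
      intro!: sum.cong)

lemma wedge_form_units:
  assumes "(i, j) \<in> index_pairs n"
  shows "wedge_form n b (\<lambda>k. if k = i then 1 else 0) (\<lambda>k. if k = j then 1 else 0) = b (i, j)"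
proof -
  have "wedge_form n b (\<lambda>k. if k = i then 1 else 0) (\<lambda>k. if k = j then 1 else 0)
    = (\<Sum>q\<in>index_pairs n. if q = (i, j) then b (i, j) else 0)"
    unfolding wedge_form_def using assms
    by (intro sum.cong) (auto simp: index_pairs_def split: if_splits)
  also have "\<dots> = b (i, j)" using assms by simp
  finally show ?thesis .
qed

text \<open>The dual reading of the theorem on pencils: a bivector outside the span of two others is separated from
them by a decomposable form.  Evaluating at unit vectors turns an identity of forms into one of
coordinates.\<close>

lemma decomposable_form_separates:
  fixes p :: int
  assumes p: "prime p"
    and b: "\<not> (\<exists>c d. \<forall>q \<in> index_pairs n. p dvd b q - c * u q - d * v q)"
  obtains l m where "p dvd wedge_form n u l m" "p dvd wedge_form n v l m"
    "\<not> p dvd wedge_form n b l m"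
proof (rule ccontr)
  assume "\<not> thesis"
  with that have *: "p dvd wedge_form n b l m" if "p dvd wedge_form n u l m" "p dvd wedge_form n v l m" for l m
    using that by blast
  show False
  proof (rule alternating_form_vanishing_with_two
      [OF p alternating_wedge_form[of n u] alternating_wedge_form[of n v] alternating_wedge_form[of n b]])
    show "p dvd wedge_form n b l m" if "p dvd wedge_form n u l m" "p dvd wedge_form n v l m" for l m
      using that by (rule *)
    fix c d
    assume cd: "p dvd wedge_form n b l m - c * wedge_form n u l m - d * wedge_form n v l m" for l m
    have "p dvd b q - c * u q - d * v q" if "q \<in> index_pairs n" for q
      using cd[of "\<lambda>k. if k = fst q then 1 else 0" "\<lambda>k. if k = snd q then 1 else 0"] that
        wedge_form_units[of "fst q" "snd q"] by simp
    with b show False by blast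
  qed
qed

text \<open>In a finite \<open>p\<close>-group irredundance of the generators is the same as minimality of their number.\<close>

locale class_two_presentation = class_two_exponent +
  fixes n :: nat and x :: "nat \<Rightarrow> 'a"
  assumes x_closed: "i \<in> {1..n} \<Longrightarrow> x i \<in> carrier G"
    and x_generate: "generate G (x ` {1..n}) = carrier G"
    and x_irredundant: "i \<in> {1..n} \<Longrightarrow> generate G (x ` ({1..n} - {i})) \<noteq> carrier G"
begin

definition basic_commutator :: "nat \<times> nat \<Rightarrow> 'a" where "basic_commutator q = C (x (fst q)) (x (snd q))"
abbreviation "P \<equiv> index_pairs n"
abbreviation "T \<equiv> {1..n} <+> P"
abbreviation "y \<equiv> case_sum x basic_commutator"

lemma basic_commutator_derived: "q \<in> P \<Longrightarrow> basic_commutator q \<in> D"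
  by (auto simp: basic_commutator_def index_pairs_def intro!: commutator_in_derived x_closed)

lemma basic_commutator_closed: "basic_commutator \<in> P \<rightarrow> carrier G"
  using basic_commutator_derived derived_subset_center center_closed by blast

lemma y_closed: "y \<in> T \<rightarrow> carrier G"
  using basic_commutator_closed x_closed by (auto simp: Pi_iff)

text \<open>Commutators are bilinear, so those of generators suffice; the ones with \<open>i \<ge> j\<close> are trivial or
inverses of listed ones.\<close>

lemma generate_basic_commutators: "generate G (basic_commutator ` P) = D"
proof
  have cP: "basic_commutator ` P \<subseteq> D" using basic_commutator_derived by blast
  show "generate G (basic_commutator ` P) \<subseteq> D" by (rule generate_subgroup_incl[OF cP derived_subgroup])
  have sub: "subgroup (generate G (basic_commutator ` P)) G"
    by (rule generate_is_subgroup) (use cP derived_subset_center center_closed in blast)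
  show "D \<subseteq> generate G (basic_commutator ` P)"
  proof (rule derived_in_subgroup_if_generators[OF _ x_generate sub])
    show "x ` {1..n} \<subseteq> carrier G" using x_closed by blast
    fix g h assume "g \<in> x ` {1..n}" "h \<in> x ` {1..n}"
    then obtain i j where ij: "g = x i" "h = x j" "i \<in> {1..n}" "j \<in> {1..n}" by blast
    have lt: "C (x i) (x j) \<in> generate G (basic_commutator ` P)" if "i < j" "i \<in> {1..n}" "j \<in> {1..n}" for i j
      using that by (intro generate.incl image_eqI[of _ _ "(i, j)"]) (auto simp: index_pairs_def basic_commutator_def)
    consider "i < j" | "i = j" | "j < i" by linarith
    then show "C g h \<in> generate G (basic_commutator ` P)"
    proof cases
      case 1
      then show ?thesis using lt ij by simp
    next
      case 2
      then show ?thesis using ij commutator_self[OF x_closed] by (simp add: generate.one)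
    next
      case 3
      have "C (x i) (x j) = inv (C (x j) (x i))"
        using ij x_closed by (intro commutator_swap) auto
      then show ?thesis using lt[OF 3] ij subgroup.m_inv_closed[OF sub] by simp
    qed
  qed
qed

lemma baer_generate_basic_commutators: "Q \<subseteq> P \<Longrightarrow> generate L (basic_commutator ` Q) = generate G (basic_commutator ` Q)"
  by (rule baer_generate_center) (use basic_commutator_derived derived_subset_center in blast)

text \<open>The subgroup generated in the abelian group contains the derived subgroup, so it is a subgroup of \<open>G\<close> as
well, and it contains the generators of \<open>G\<close>.\<close>

lemma baer_generate_y: "generate L (y ` T) = carrier G"
proof
  have yT: "y ` T \<subseteq> carrier L" using y_closed by auto
  have sub: "subgroup (generate L (y ` T)) L"
    by (rule baer.generate_is_subgroup) (use yT in simp)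
  then show "generate L (y ` T) \<subseteq> carrier G"
    using subgroup.subset by fastforce
  have "generate L (basic_commutator ` P) \<subseteq> generate L (y ` T)"
    by (rule baer.mono_generate) force
  then have D: "D \<subseteq> generate L (y ` T)" using baer_generate_basic_commutators[of P] generate_basic_commutators by simp
  with sub have "subgroup (generate L (y ` T)) G" by (simp add: subgroup_baer_iff)
  moreover have "x ` {1..n} \<subseteq> generate L (y ` T)"
    by (intro subsetI generate.incl) force
  ultimately show "carrier G \<subseteq> generate L (y ` T)"
    using generate_subgroup_incl x_generate by metis
qed

text \<open>The derived subgroup consists of nongenerators: an invertible coefficient at \<open>x i\<close> would put
\<open>x i\<close> into the subgroup \<open>S\<close> generated by the other generators and all commutators, so \<open>S = G\<close>.  Commutators
only depend on arguments modulo the centre, hence the other generators alone would already produce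
all commutators and so all of \<open>G\<close>.\<close>

lemma relation_coefficients:
  assumes a: "baer.combination y T a = \<one>"
  shows "i \<in> {1..n} \<Longrightarrow> int p dvd a (Inl i)" and "baer.combination basic_commutator P (a \<circ> Inr) = \<one>"
proof -
  show dv: "int p dvd a (Inl i)" if i: "i \<in> {1..n}" for i
  proof (rule ccontr)
    assume nd: "\<not> int p dvd a (Inl i)"
    define A where "A = x ` ({1..n} - {i})"
    have A: "A \<subseteq> carrier G" using x_closed by (auto simp: A_def)
    define S where "S = generate G (A \<union> D)"
    have Dc: "D \<subseteq> carrier G" by (rule derived_in_carrier) simp
    have S: "subgroup S G" unfolding S_def by (rule generate_is_subgroup) (use A Dc in blast)
    have DS: "D \<subseteq> S" unfolding S_def by (auto intro: generate.incl)
    have SL: "subgroup S L" using S subgroup_baer_iff[OF DS] by simp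
    have rest: "y t \<in> S" if "t \<in> T - {Inl i}" for t
    proof (cases t)
      case (Inl j)
      then have "y t \<in> A" using that by (auto simp: A_def)
      then show ?thesis unfolding S_def by (intro generate.incl) blast
    next
      case (Inr q)
      then show ?thesis using that basic_commutator_derived[of q] DS by auto
    qed
    have "y (Inl i) \<in> S"
    proof (rule baer.isolate_generator[where y = y and q = "Inl i" and a = a and T = T, OF SL])
      show "finite T" by simp
      show "y \<in> T \<rightarrow> carrier G" by (rule y_closed)
      show "Inl i \<in> T" using i by (rule InlI)
      show "y (Inl i) [^]\<^bsub>L\<^esub> p = \<one>" using baer_exponent[OF x_closed[OF i]] by simp
      show "prime p" by (rule prime_p)
      show "\<not> int p dvd a (Inl i)" by (rule nd)
      show "baer.combination y T a \<in> S" using a subgroup.one_closed[OF S] by simp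
      show "y t [^]\<^bsub>L\<^esub> a t \<in> S" if "t \<in> T - {Inl i}" for t
        by (rule baer.subgroup_int_pow_closed[OF SL rest[OF that]])
    qed
    then have "x ` {1..n} \<subseteq> S" using rest[of "Inl _"] by fastforce
    then have Sfull: "S = carrier G"
      using generate_subgroup_incl[OF _ S] x_generate subgroup.subset[OF S] by blast
    \<comment> \<open>\<open>S'\<close> contains all commutators of \<open>A \<union> D\<close>, a generating set of \<open>G\<close>, because those with an entry in \<open>D\<close> are trivial.\<close>
    define S' where "S' = generate G A"
    have S': "subgroup S' G" unfolding S'_def by (rule generate_is_subgroup[OF A])
    have "D \<subseteq> S'"
    proof (rule derived_in_subgroup_if_generators[OF _ Sfull[unfolded S_def] S'])
      show "A \<union> D \<subseteq> carrier G" using A Dc by blast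
      fix g h assume gh: "g \<in> A \<union> D" "h \<in> A \<union> D"
      show "C g h \<in> S'"
      proof (cases "g \<in> A \<and> h \<in> A")
        case True
        then have "g \<in> S'" "h \<in> S'" by (auto simp: S'_def intro: generate.incl)
        then show ?thesis unfolding commutator_def
          using S' by (intro subgroup.m_closed subgroup.m_inv_closed)
      next
        case False
        then have "g \<in> Z \<or> h \<in> Z" using gh derived_subset_center by blast
        then have "C g h = \<one>" using commutator_center gh A Dc by blast
        then show ?thesis using subgroup.one_closed[OF S'] by simp
      qed
    qed
    then have "A \<union> D \<subseteq> S'" unfolding S'_def by (auto intro: generate.incl)
    then have "S \<subseteq> S'" unfolding S_def by (rule generate_subgroup_incl[OF _ S'])
    then have "generate G A = carrier G" using Sfull S'_def subgroup.subset[OF S'] by blast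
    then show False using x_irredundant[OF i] by (simp add: A_def)
  qed
  have one: "baer.combination x {1..n} (a \<circ> Inl) = \<one>"
    by (rule baer.combination_trivial) (use dv x_closed baer_exponent in auto)
  have "baer.combination y T a = baer.combination x {1..n} (a \<circ> Inl) \<otimes>\<^bsub>L\<^esub> baer.combination basic_commutator P (a \<circ> Inr)"
    by (rule baer.combination_Plus) (use x_closed basic_commutator_closed in auto)
  then show "baer.combination basic_commutator P (a \<circ> Inr) = \<one>"
    using one a baer.combination_closed[OF basic_commutator_closed] by simp
qed

lemma sum_T:
  "(\<Sum>t\<in>T. a t * case_sum v w t) = (\<Sum>i=1..n. a (Inl i) * v i) + (\<Sum>q\<in>P. (a \<circ> Inr) q * w q)"
  by (simp add: sum.Plus)

lemma baer_hom_extension: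
  assumes w: "\<forall>b. baer.combination basic_commutator P b = \<one> \<longrightarrow> int p dvd (\<Sum>q\<in>P. b q * w q)"
  shows "\<exists>f. hom_mod L (int p) f \<and>
    (\<forall>a. [f (baer.combination y T a) =
        (\<Sum>i=1..n. a (Inl i) * v i) + (\<Sum>q\<in>P. (a \<circ> Inr) q * w q)] (mod int p)) \<and>
    (\<forall>i \<in> {1..n}. [f (x i) = v i] (mod int p)) \<and>
    (\<forall>q \<in> P. [f (basic_commutator q) = w q] (mod int p))"
proof -
  have rel: "int p dvd (\<Sum>t\<in>T. a t * case_sum v w t)" if "baer.combination y T a = \<one>" for a
    unfolding sum_T
  proof (rule dvd_add)
    show "int p dvd (\<Sum>i=1..n. a (Inl i) * v i)"
      using relation_coefficients(1)[OF that] by (intro dvd_sum dvd_mult2)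
    show "int p dvd (\<Sum>q\<in>P. (a \<circ> Inr) q * w q)"
      using w relation_coefficients(2)[OF that] by blast
  qed
  have T: "finite T" by simp
  obtain f where f: "hom_mod L (int p) f"
    "\<And>a. [f (baer.combination y T a) = (\<Sum>t\<in>T. a t * case_sum v w t)] (mod int p)"
    using baer.hom_mod_extension[OF T y_closed baer_generate_y rel] by blast
  have unit: "[f (y t) = case_sum v w t] (mod int p)" if t: "t \<in> T" for t
  proof -
    have "(\<Sum>s\<in>T. (if s = t then 1 else 0) * case_sum v w s) = (\<Sum>s\<in>T. if s = t then case_sum v w s else 0)"
      by (rule sum.cong) auto
    also have "\<dots> = case_sum v w t" using t T by simp
    finally show ?thesis
      using f(2)[of "\<lambda>s. if s = t then 1 else 0"] baer.combination_unit[OF T y_closed t] by simp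
  qed
  show ?thesis
  proof (intro exI[of _ f] conjI f(1) allI ballI)
    show "[f (baer.combination y T a) =
        (\<Sum>i=1..n. a (Inl i) * v i) + (\<Sum>q\<in>P. (a \<circ> Inr) q * w q)] (mod int p)" for a
      using f(2) unfolding sum_T .
    show "[f (x i) = v i] (mod int p)" if "i \<in> {1..n}" for i
      using unit[OF InlI[OF that]] by simp
    show "[f (basic_commutator q) = w q] (mod int p)" if "q \<in> P" for q
      using unit[OF InrI[OF that]] by simp
  qed
qed

lemma derived_hom_vanishes:
  assumes f: "hom_mod L (int p) f" and c: "\<forall>q \<in> P. [f (basic_commutator q) = 0] (mod int p)" and z: "z \<in> D"
  shows "[f z = 0] (mod int p)"
proof -
  have "basic_commutator ` P \<subseteq> {g \<in> carrier G. [f g = 0] (mod int p)}" using c basic_commutator_closed by auto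
  then have "generate L (basic_commutator ` P) \<subseteq> {g \<in> carrier G. [f g = 0] (mod int p)}"
    by (rule baer.generate_subgroup_incl) (rule baer.hom_mod_kernel_subgroup[OF f])
  then show ?thesis using z baer_generate_basic_commutators[of P] generate_basic_commutators by auto
qed

text \<open>The map exists on the abelian group by prescribing values on generators: \<open>l\<close> and \<open>m\<close> on the \<open>x i\<close> give \<open>\<alpha>\<close>
and \<open>\<mu>\<close>, and a form \<open>\<beta>\<close> takes the values \<open>s i\<close> on the \<open>x i\<close> and those of \<open>l \<and> m\<close> on the commutators.  By
bilinearity \<open>\<beta> [g,h] = \<alpha> g * \<mu> h - \<alpha> h * \<mu> g\<close> for all \<open>g, h\<close>, and \<open>\<gamma> = 2 \<beta> + \<alpha> \<mu>\<close> turns this skew correction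
into the one-sided correction \<open>2 \<alpha> g * \<mu> h\<close> of the Heisenberg group.\<close>

lemma heisenberg_map:
  assumes rel: "\<forall>b. baer.combination basic_commutator P b = \<one> \<longrightarrow> int p dvd wedge_form n b l m"
  shows "\<exists>\<alpha> \<mu> \<gamma>. hom_mod G (int p) \<alpha> \<and> hom_mod G (int p) \<mu> \<and>
    (\<forall>g \<in> carrier G. \<forall>h \<in> carrier G. [\<gamma> (g \<otimes> h) = \<gamma> g + \<gamma> h + 2 * (\<alpha> g * \<mu> h)] (mod int p)) \<and>
    (\<forall>i \<in> {1..n}. [\<alpha> (x i) = l i] (mod int p) \<and> [\<mu> (x i) = m i] (mod int p)) \<and>
    (\<forall>a. [\<gamma> (baer.combination y T a) = 2 * ((\<Sum>i=1..n. a (Inl i) * s i) + wedge_form n (a \<circ> Inr) l m)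
        + \<alpha> (baer.combination y T a) * \<mu> (baer.combination y T a)] (mod int p))"
proof -
  define w where "w q = l (fst q) * m (snd q) - l (snd q) * m (fst q)" for q
  have wedge: "wedge_form n b l m = (\<Sum>q\<in>P. b q * w q)" for b
    by (simp add: wedge_form_def w_def case_prod_beta)
  have zero: "\<forall>b. baer.combination basic_commutator P b = \<one> \<longrightarrow> int p dvd (\<Sum>q\<in>P. b q * 0)" by simp
  obtain \<alpha> where \<alpha>: "hom_mod L (int p) \<alpha>" "\<forall>i \<in> {1..n}. [\<alpha> (x i) = l i] (mod int p)"
    "\<forall>q \<in> P. [\<alpha> (basic_commutator q) = 0] (mod int p)"
    using baer_hom_extension[where v = l and w = "\<lambda>_. 0", OF zero] by (elim exE conjE) blast
  obtain \<mu> where \<mu>: "hom_mod L (int p) \<mu>" "\<forall>i \<in> {1..n}. [\<mu> (x i) = m i] (mod int p)"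
    "\<forall>q \<in> P. [\<mu> (basic_commutator q) = 0] (mod int p)"
    using baer_hom_extension[where v = m and w = "\<lambda>_. 0", OF zero] by (elim exE conjE) blast
  obtain \<beta> where \<beta>: "hom_mod L (int p) \<beta>"
    "\<forall>a. [\<beta> (baer.combination y T a) =
        (\<Sum>i=1..n. a (Inl i) * s i) + (\<Sum>q\<in>P. (a \<circ> Inr) q * w q)] (mod int p)"
    "\<forall>q \<in> P. [\<beta> (basic_commutator q) = w q] (mod int p)"
    using baer_hom_extension[where v = s and w = w, OF rel[unfolded wedge]] by (elim exE conjE) blast
  have split: "[f (g \<otimes> h) = f g + f h + f (C g h [^] half_p)] (mod int p)"
    if f: "hom_mod L (int p) f" and gh: "g \<in> carrier G" "h \<in> carrier G" for f g h
  proof -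
    have 1: "[f (g \<otimes> h) = f (g \<otimes>\<^bsub>L\<^esub> h) + f (C g h [^] half_p)] (mod int p)"
      unfolding mult_eq_baer[OF gh] by (rule hom_modD[OF f]) (use gh commutator_closed baer.m_closed in auto)
    have 2: "[f (g \<otimes>\<^bsub>L\<^esub> h) + f (C g h [^] half_p) = f g + f h + f (C g h [^] half_p)] (mod int p)"
      by (intro cong_add cong_refl hom_modD[OF f]) (use gh in auto)
    show ?thesis using 1 2 by (rule cong_trans)
  qed
  have hom: "hom_mod G (int p) f"
    if f: "hom_mod L (int p) f" and c: "\<forall>q \<in> P. [f (basic_commutator q) = 0] (mod int p)" for f
    unfolding hom_mod_def
  proof (intro ballI)
    fix g h assume gh: "g \<in> carrier G" "h \<in> carrier G"
    have "[f g + f h + f (C g h [^] half_p) = f g + f h + 0] (mod int p)"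
      by (intro cong_add cong_refl derived_hom_vanishes[OF f c] derived_pow commutator_in_derived gh)
    then show "[f (g \<otimes> h) = f g + f h] (mod int p)" using split[OF f gh] cong_trans by fastforce
  qed
  note \<alpha>G = hom[OF \<alpha>(1,3)] and \<mu>G = hom[OF \<mu>(1,3)]
  have center_add: "[\<beta> (z \<otimes> g) = \<beta> z + \<beta> g] (mod int p)" if "z \<in> Z" "g \<in> carrier G" for z g
    using hom_modD[OF \<beta>(1), of z g] that by (simp add: baer_mult_center center_closed)
  \<comment> \<open>The defect of the formula for \<open>\<beta>\<close> on commutators; it is a homomorphism in \<open>g\<close>.\<close>
  define E where "E h g = \<beta> (C g h) - (\<alpha> g * \<mu> h - \<alpha> h * \<mu> g)" for g h
  have E_hom: "hom_mod G (int p) (E h)" if h: "h \<in> carrier G" for h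
    unfolding hom_mod_def
  proof (intro ballI)
    fix g k assume gk: "g \<in> carrier G" "k \<in> carrier G"
    have b: "[\<beta> (C (g \<otimes> k) h) = \<beta> (C g h) + \<beta> (C k h)] (mod int p)"
      using center_add[of "C g h" "C k h"] gk h
      by (simp add: commutator_mult_left commutator_central commutator_closed)
    have "[E h (g \<otimes> k) = \<beta> (C g h) + \<beta> (C k h) - ((\<alpha> g + \<alpha> k) * \<mu> h - \<alpha> h * (\<mu> g + \<mu> k))] (mod int p)"
      unfolding E_def
      by (intro cong_diff cong_mult b cong_refl hom_modD[OF \<alpha>G gk] hom_modD[OF \<mu>G gk])
    then show "[E h (g \<otimes> k) = E h g + E h k] (mod int p)" by (simp add: E_def algebra_simps)
  qed
  have E_swap: "[E g h = - E h g] (mod int p)" if gh: "g \<in> carrier G" "h \<in> carrier G" for g h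
  proof -
    have "[\<beta> (C g h \<otimes> C h g) = \<beta> (C g h) + \<beta> (C h g)] (mod int p)"
      by (intro center_add commutator_central commutator_closed gh)
    moreover have "C g h \<otimes> C h g = \<one>" using gh commutator_closed by (simp add: commutator_swap[of g h])
    ultimately have "[\<beta> (C g h) + \<beta> (C h g) = 0] (mod int p)"
      using baer.hom_mod_one[OF \<beta>(1)] by (metis cong_sym cong_trans)
    then show ?thesis unfolding E_def by (simp add: cong_iff_dvd_diff algebra_simps)
  qed
  have \<beta>_comm: "[\<beta> (C g h) = \<alpha> g * \<mu> h - \<alpha> h * \<mu> g] (mod int p)"
    if gh: "g \<in> carrier G" "h \<in> carrier G" for g h
  proof -
    have "[E h g = 0] (mod int p)"
    proof (rule generate_induct_symmetric[where R = "\<lambda>g h. [E h g = 0] (mod int p)", OF _ x_generate])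
      show "x ` {1..n} \<subseteq> carrier G" using x_closed by blast
      have lt: "[E (x j) (x i) = 0] (mod int p)" if "i < j" "i \<in> {1..n}" "j \<in> {1..n}" for i j
      proof -
        have ij: "(i, j) \<in> P" using that by (auto simp: index_pairs_def)
        have "[E (x j) (x i) = w (i, j) - (l i * m j - l j * m i)] (mod int p)"
          unfolding E_def using \<beta>(3)[rule_format, OF ij] that
          by (intro cong_diff cong_mult \<alpha>(2)[rule_format] \<mu>(2)[rule_format]) (simp_all add: basic_commutator_def)
        then show ?thesis by (simp add: w_def)
      qed
      fix g h assume "g \<in> x ` {1..n}" "h \<in> x ` {1..n}"
      then obtain i j where ij: "g = x i" "h = x j" "i \<in> {1..n}" "j \<in> {1..n}" by blast
      consider "i < j" | "i = j" | "j < i" by linarith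
      then show "[E h g = 0] (mod int p)"
      proof cases
        case 1
        then show ?thesis using lt ij by simp
      next
        case 2
        then show ?thesis
          using ij x_closed[of i] baer.hom_mod_one[OF \<beta>(1)] by (simp add: E_def commutator_self)
      next
        case 3
        have "[E h g = - E g h] (mod int p)" using E_swap ij x_closed by auto
        moreover have "[- E g h = - 0] (mod int p)" 
          using lt[OF 3 ij(4) ij(3)] unfolding ij cong_minus_minus_iff .
        ultimately show ?thesis using cong_trans by fastforce
      qed
    next
      show "subgroup {g \<in> carrier G. [E h g = 0] (mod int p)} G" if "h \<in> carrier G" for h
        by (rule hom_mod_kernel_subgroup[OF E_hom[OF that]])
    next
      fix g h assume gh: "g \<in> carrier G" "h \<in> carrier G" and 0: "[E h g = 0] (mod int p)"
      have "[- E h g = - 0] (mod int p)" using 0 by (simp only: cong_minus_minus_iff)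
      then show "[E g h = 0] (mod int p)" using E_swap[OF gh] cong_trans by fastforce
    qed (use gh in auto)
    then show ?thesis by (simp add: E_def cong_iff_dvd_diff)
  qed
  define \<gamma> where "\<gamma> g = 2 * \<beta> g + \<alpha> g * \<mu> g" for g
  have \<gamma>_mult: "[\<gamma> (g \<otimes> h) = \<gamma> g + \<gamma> h + 2 * (\<alpha> g * \<mu> h)] (mod int p)"
    if gh: "g \<in> carrier G" "h \<in> carrier G" for g h
  proof -
    have cl: "C g h \<in> carrier G" using gh by (rule commutator_closed)
    have "[\<beta> (C g h [^] half_p \<otimes> C g h [^] half_p) = \<beta> (C g h [^] half_p) + \<beta> (C g h [^] half_p)] (mod int p)"
      by (intro center_add pow_center commutator_central gh nat_pow_closed cl)
    then have twice: "[2 * \<beta> (C g h [^] half_p) = \<beta> (C g h)] (mod int p)"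
      using pow_half_twice[OF cl] by (simp add: cong_sym)
    have "[\<gamma> (g \<otimes> h) = 2 * (\<beta> g + \<beta> h + \<beta> (C g h [^] half_p)) + (\<alpha> g + \<alpha> h) * (\<mu> g + \<mu> h)] (mod int p)"
      unfolding \<gamma>_def
      by (intro cong_add cong_mult cong_refl split[OF \<beta>(1) gh] hom_modD[OF \<alpha>G gh] hom_modD[OF \<mu>G gh])
    also have "2 * (\<beta> g + \<beta> h + \<beta> (C g h [^] half_p)) + (\<alpha> g + \<alpha> h) * (\<mu> g + \<mu> h)
       = 2 * (\<beta> g + \<beta> h) + 2 * \<beta> (C g h [^] half_p) + (\<alpha> g + \<alpha> h) * (\<mu> g + \<mu> h)"
      by simp
    also have "[\<dots> = 2 * (\<beta> g + \<beta> h) + (\<alpha> g * \<mu> h - \<alpha> h * \<mu> g) + (\<alpha> g + \<alpha> h) * (\<mu> g + \<mu> h)] (mod int p)"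
      by (intro cong_add cong_refl cong_trans[OF twice \<beta>_comm[OF gh]])
    also have "2 * (\<beta> g + \<beta> h) + (\<alpha> g * \<mu> h - \<alpha> h * \<mu> g) + (\<alpha> g + \<alpha> h) * (\<mu> g + \<mu> h)
       = \<gamma> g + \<gamma> h + 2 * (\<alpha> g * \<mu> h)"
      by (simp add: \<gamma>_def algebra_simps)
    finally show ?thesis .
  qed
  have val: "[\<gamma> (baer.combination y T a) = 2 * ((\<Sum>i=1..n. a (Inl i) * s i) + wedge_form n (a \<circ> Inr) l m)
        + \<alpha> (baer.combination y T a) * \<mu> (baer.combination y T a)] (mod int p)" for a
    unfolding \<gamma>_def wedge by (intro cong_add cong_mult cong_refl \<beta>(2)[rule_format])
  show ?thesis
    by (rule exI[of _ \<alpha>], rule exI[of _ \<mu>], rule exI[of _ \<gamma>])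
      (intro conjI ballI allI \<alpha>G \<mu>G \<gamma>_mult \<alpha>(2)[rule_format] \<mu>(2)[rule_format] val)
qed

text \<open>Comparing \<open>\<gamma> (z \<otimes> x k)\<close> and \<open>\<gamma> (x k \<otimes> z)\<close> for a central \<open>z\<close> shows that \<open>(\<alpha> z, \<mu> z)\<close> is proportional to each
\<open>(l k, m k)\<close>.  Two of these vectors are independent, since \<open>l \<and> m\<close> is nonzero, so \<open>\<alpha> z = \<mu> z = 0\<close>.  Then only
\<open>\<alpha> (x k) * \<gamma> z\<close> survives in the commutator of lifts of \<open>x k\<close> and \<open>z\<close>.\<close>

lemma heisenberg_cocycle_detects:
  assumes rel: "\<forall>b. baer.combination basic_commutator P b = \<one> \<longrightarrow> int p dvd wedge_form n b l m"
    and b: "\<not> int p dvd wedge_form n b l m"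
    and z: "z \<in> Z" "z = baer.combination y T a"
    and nz: "\<not> int p dvd (\<Sum>i=1..n. a (Inl i) * s i) + wedge_form n (a \<circ> Inr) l m"
  shows "\<exists>f. cocycle_mod G (int p) f \<and> (\<exists>h \<in> carrier G. \<not> [f z h = f h z] (mod int p))"
proof -
  obtain \<alpha> \<mu> \<gamma> where \<alpha>: "hom_mod G (int p) \<alpha>" and \<mu>: "hom_mod G (int p) \<mu>"
    and \<gamma>: "\<forall>g \<in> carrier G. \<forall>h \<in> carrier G. [\<gamma> (g \<otimes> h) = \<gamma> g + \<gamma> h + 2 * (\<alpha> g * \<mu> h)] (mod int p)"
    and x: "\<forall>i \<in> {1..n}. [\<alpha> (x i) = l i] (mod int p) \<and> [\<mu> (x i) = m i] (mod int p)"
    and val: "\<forall>a. [\<gamma> (baer.combination y T a) = 2 * ((\<Sum>i=1..n. a (Inl i) * s i) + wedge_form n (a \<circ> Inr) l m)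
        + \<alpha> (baer.combination y T a) * \<mu> (baer.combination y T a)] (mod int p)"
    using heisenberg_map[where l = l and m = m and s = s, OF rel] by (elim exE conjE) blast
  have \<alpha>x: "[\<alpha> (x i) = l i] (mod int p)" and \<mu>x: "[\<mu> (x i) = m i] (mod int p)" if "i \<in> {1..n}" for i
    using x that by blast+
  have p: "prime (int p)" using prime_p by simp
  have "p \<noteq> 2" using odd_p by auto
  then have two: "\<not> int p dvd 2"
    using prime_p primes_dvd_imp_eq[OF prime_p two_is_prime_nat] by (metis int_dvd_int_iff of_nat_numeral)
  have zc: "z \<in> carrier G" using z(1) by (rule center_closed)
  obtain q where q: "q \<in> P" "\<not> int p dvd l (fst q) * m (snd q) - l (snd q) * m (fst q)"
  proof (rule ccontr)
    assume "\<not> thesis"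
    with that have "\<And>q. q \<in> P \<Longrightarrow> int p dvd l (fst q) * m (snd q) - l (snd q) * m (fst q)" by blast
    then have "int p dvd wedge_form n b l m"
      unfolding wedge_form_def by (intro dvd_sum) (auto intro!: dvd_mult)
    with b show False by blast
  qed
  define i j where "i = fst q" and "j = snd q"
  have ij: "i \<in> {1..n}" "j \<in> {1..n}" using q(1) by (auto simp: index_pairs_def i_def j_def)
  have central: "int p dvd \<alpha> z * m k - l k * \<mu> z" if k: "k \<in> {1..n}" for k
  proof -
    note xk = x_closed[OF k]
    have "[\<gamma> z + \<gamma> (x k) + 2 * (\<alpha> z * \<mu> (x k)) = \<gamma> (x k) + \<gamma> z + 2 * (\<alpha> (x k) * \<mu> z)] (mod int p)"
      using \<gamma>[rule_format, OF zc xk] \<gamma>[rule_format, OF xk zc] center_comm[OF z(1) xk]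
      by (simp add: cong_def)
    then have "int p dvd 2 * (\<alpha> z * \<mu> (x k) - \<alpha> (x k) * \<mu> z)"
      by (simp add: cong_iff_dvd_diff algebra_simps)
    then have "int p dvd \<alpha> z * \<mu> (x k) - \<alpha> (x k) * \<mu> z" using p two prime_dvd_multD by blast
    moreover have "[\<alpha> z * \<mu> (x k) - \<alpha> (x k) * \<mu> z = \<alpha> z * m k - l k * \<mu> z] (mod int p)"
      by (intro cong_diff cong_mult cong_refl \<alpha>x \<mu>x k)
    ultimately show ?thesis using cong_dvd_iff by blast
  qed
  have nd: "\<not> int p dvd l i * m j - l j * m i" using q(2) by (simp add: i_def j_def)
  have "int p dvd (l i * m j - l j * m i) * \<alpha> z"
    by (rule dvd_combine[OF central[OF ij(1)] central[OF ij(2)], where r = "- l j" and s = "l i"])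
      (simp add: algebra_simps)
  then have \<alpha>z: "int p dvd \<alpha> z" using nd p prime_dvd_multD by blast
  have "int p dvd (l i * m j - l j * m i) * \<mu> z"
    by (rule dvd_combine[OF central[OF ij(1)] central[OF ij(2)], where r = "- m j" and s = "m i"])
      (simp add: algebra_simps)
  then have \<mu>z: "int p dvd \<mu> z" using nd p prime_dvd_multD by blast
  obtain k where k: "k \<in> {1..n}" "\<not> int p dvd l k"
    using nd ij by (metis dvd_diff dvd_mult2)
  have \<alpha>k: "\<not> int p dvd \<alpha> (x k)" using k \<alpha>x cong_dvd_iff by blast
  have "\<not> int p dvd 2 * ((\<Sum>i=1..n. a (Inl i) * s i) + wedge_form n (a \<circ> Inr) l m)"
    using nz p two prime_dvd_multD by blast
  then have \<gamma>z: "\<not> int p dvd \<gamma> z"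
    using val[rule_format, of a] z(2) \<alpha>z by (metis cong_dvd_iff dvd_add_left_iff dvd_mult2)
  let ?f = "\<lambda>g h. \<alpha> g * \<gamma> h + (\<alpha> g)\<^sup>2 * \<mu> h"
  have "\<not> [?f z (x k) = ?f (x k) z] (mod int p)"
  proof
    assume "[?f z (x k) = ?f (x k) z] (mod int p)"
    then have h: "int p dvd ?f z (x k) - ?f (x k) z" by (simp add: cong_iff_dvd_diff)
    have "int p dvd \<alpha> (x k) * \<gamma> z"
      by (rule dvd_combine3[OF h \<alpha>z \<mu>z, where r = "-1" and s = "\<gamma> (x k) + \<alpha> z * \<mu> (x k)" and t = "- ((\<alpha> (x k))\<^sup>2)"])
        (simp add: algebra_simps power2_eq_square)
    then show False using \<alpha>k \<gamma>z p prime_dvd_multD by blast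
  qed
  moreover have "cocycle_mod G (int p) ?f" by (rule heisenberg_cocycle[OF \<alpha> \<mu>]) (rule \<gamma>[rule_format])
  ultimately show ?thesis using x_closed[OF k(1)] by blast
qed

lemma nonrelation_not_spanned:
  assumes u: "baer.combination basic_commutator P u = \<one>" and v: "baer.combination basic_commutator P v = \<one>"
    and b: "baer.combination basic_commutator P b \<noteq> \<one>"
  shows "\<not> (\<exists>d e. \<forall>q \<in> P. int p dvd b q - d * u q - e * v q)"
proof
  assume "\<exists>d e. \<forall>q \<in> P. int p dvd b q - d * u q - e * v q"
  then obtain d e where de: "\<forall>q \<in> P. int p dvd b q - d * u q - e * v q" by blast
  have fP: "finite P" by simp
  have triv: "baer.combination basic_commutator P (\<lambda>q. b q - d * u q - e * v q) = \<one>"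
    by (rule baer.combination_trivial) (use de basic_commutator_closed baer_exponent in \<open>auto simp: Pi_iff\<close>)
  have du: "baer.combination basic_commutator P (\<lambda>q. d * u q) = \<one>" "baer.combination basic_commutator P (\<lambda>q. e * v q) = \<one>"
    using baer.combination_scale[OF fP basic_commutator_closed] u v by simp_all
  have "baer.combination basic_commutator P (\<lambda>q. b q - d * u q - e * v q) = baer.combination basic_commutator P b"
    unfolding baer.combination_diff[OF fP basic_commutator_closed] du
    using baer.combination_closed[OF basic_commutator_closed] by simp
  with triv b show False by simp
qed

text \<open>A central element with trivial coordinates at the \<open>x i\<close> lies in the derived subgroup and is detected by a
form separating it from the relations.  Otherwise any nonzero \<open>l \<and> m\<close> that kills the relations serves,
because \<open>s\<close> can be chosen to make the value of \<open>\<gamma>\<close> nonzero.\<close>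

theorem capable_if_relations_spanned_by_two:
  assumes u: "baer.combination basic_commutator P u = \<one>" and v: "baer.combination basic_commutator P v = \<one>"
    and span: "\<And>b. baer.combination basic_commutator P b = \<one> \<Longrightarrow> \<exists>d e. \<forall>q \<in> P. int p dvd b q - d * u q - e * v q"
    and nontrivial: "D \<noteq> {\<one>}"
  shows "capable G"
proof -
  have p: "prime (int p)" using prime_p by simp
  have forms: "\<exists>l m. (\<forall>b'. baer.combination basic_commutator P b' = \<one> \<longrightarrow> int p dvd wedge_form n b' l m) \<and>
      \<not> int p dvd wedge_form n b l m" if b: "baer.combination basic_commutator P b \<noteq> \<one>" for b
  proof -
    obtain l m where lm: "int p dvd wedge_form n u l m" "int p dvd wedge_form n v l m"
      "\<not> int p dvd wedge_form n b l m"
      using decomposable_form_separates[OF p nonrelation_not_spanned[OF u v b]] .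
    have "int p dvd wedge_form n b' l m" if b': "baer.combination basic_commutator P b' = \<one>" for b'
    proof -
      obtain d e where de: "\<forall>q \<in> P. int p dvd b' q - d * u q - e * v q" using span[OF b'] by blast
      have "int p dvd wedge_form n (\<lambda>q. b' q - d * u q - e * v q) l m"
        unfolding wedge_form_def using de by (intro dvd_sum) auto
      moreover have "wedge_form n (\<lambda>q. b' q - d * u q - e * v q) l m
          = wedge_form n b' l m - d * wedge_form n u l m - e * wedge_form n v l m"
        unfolding wedge_form_def sum_distrib_left sum_subtractf[symmetric]
        by (rule sum.cong) (auto simp: algebra_simps)
      ultimately have h: "int p dvd wedge_form n b' l m - d * wedge_form n u l m - e * wedge_form n v l m"
        by simp
      show ?thesis
        by (rule dvd_combine3[OF h lm(1) lm(2), where r = 1 and s = d and t = e]) simp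
    qed
    with lm(3) show ?thesis by blast
  qed
  have detect: "\<exists>f. cocycle_mod G (int p) f \<and> (\<exists>h \<in> carrier G. \<not> [f z h = f h z] (mod int p))"
    if z: "z \<in> Z" "z \<noteq> \<one>" for z
  proof -
    have T: "finite T" by simp
    have "z \<in> range (baer.combination y T)"
      using center_closed[OF z(1)] baer.generate_eq_combinations[OF T y_closed] baer_generate_y by simp
    then obtain a where a: "z = baer.combination y T a" by blast
    show ?thesis
    proof (cases "\<forall>i \<in> {1..n}. int p dvd a (Inl i)")
      case True
      have "baer.combination x {1..n} (a \<circ> Inl) = \<one>"
        by (rule baer.combination_trivial) (use True x_closed baer_exponent in auto)
      moreover have "z = baer.combination x {1..n} (a \<circ> Inl) \<otimes>\<^bsub>L\<^esub> baer.combination basic_commutator P (a \<circ> Inr)"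
        unfolding a by (rule baer.combination_Plus) (use x_closed basic_commutator_closed in \<open>auto simp: Pi_iff\<close>)
      ultimately have "baer.combination basic_commutator P (a \<circ> Inr) \<noteq> \<one>"
        using z(2) by auto
      then obtain l m where lm: "\<forall>b'. baer.combination basic_commutator P b' = \<one> \<longrightarrow> int p dvd wedge_form n b' l m"
        "\<not> int p dvd wedge_form n (a \<circ> Inr) l m" using forms by blast
      show ?thesis
        by (rule heisenberg_cocycle_detects[where s = "\<lambda>_. 0", OF lm z(1) a]) (use lm(2) in simp)
    next
      case False
      then obtain i where i: "i \<in> {1..n}" "\<not> int p dvd a (Inl i)" by blast
      obtain d where d: "d \<in> D" "d \<noteq> \<one>" using nontrivial subgroup.one_closed[OF derived_subgroup] by blast
      have fP: "finite P" by simp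
      have "d \<in> range (baer.combination basic_commutator P)"
        using d(1) generate_basic_commutators baer_generate_basic_commutators[of P] baer.generate_eq_combinations[OF fP basic_commutator_closed] by simp
      then obtain b where "baer.combination basic_commutator P b \<noteq> \<one>" using d(2) by blast
      then obtain l m where lm: "\<forall>b'. baer.combination basic_commutator P b' = \<one> \<longrightarrow> int p dvd wedge_form n b' l m"
        "\<not> int p dvd wedge_form n b l m" using forms by blast
      define s :: "nat \<Rightarrow> int"
        where "s k = (if k = i \<and> int p dvd wedge_form n (a \<circ> Inr) l m then 1 else 0)" for k
      have "(\<Sum>k=1..n. a (Inl k) * s k)
          = (if int p dvd wedge_form n (a \<circ> Inr) l m then a (Inl i) else 0)"
      proof -
        have "(\<Sum>k=1..n. a (Inl k) * s k) = (\<Sum>k=1..n. if k = i then a (Inl i) * s i else 0)"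
          by (rule sum.cong) (auto simp: s_def)
        also have "\<dots> = a (Inl i) * s i" using i(1) by simp
        finally show ?thesis by (simp add: s_def)
      qed
      then have "\<not> int p dvd (\<Sum>k=1..n. a (Inl k) * s k) + wedge_form n (a \<circ> Inr) l m"
        using i(2) by (simp add: dvd_add_left_iff)
      then show ?thesis by (rule heisenberg_cocycle_detects[OF lm z(1) a])
    qed
  qed
  define F where "F z = (if z \<in> Z \<and> z \<noteq> \<one>
    then SOME f. cocycle_mod G (int p) f \<and> (\<exists>h \<in> carrier G. \<not> [f z h = f h z] (mod int p))
    else (\<lambda>_ _. 0))" for z
  have F: "cocycle_mod G (int p) (F z) \<and> (\<exists>h \<in> carrier G. \<not> [F z z h = F z h z] (mod int p))"
    if "z \<in> Z" "z \<noteq> \<one>" for z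
    using someI_ex[OF detect[OF that]] that by (simp add: F_def)
  show ?thesis
  proof (rule capable_if_cocycles_detect_center[where F = F and m = "int p"])
    show "int p > 0" using prime_p by (simp add: prime_gt_0_nat)
    show "cocycle_mod G (int p) (F z)" for z
    proof (cases "z \<in> Z \<and> z \<noteq> \<one>")
      case False
      then have "F z = (\<lambda>_ _. 0)" unfolding F_def by (rule if_not_P)
      then show ?thesis by (simp add: cocycle_mod_def)
    qed (use F in blast)
    show "\<exists>i. \<exists>h \<in> carrier G. \<not> [F i z h = F i h z] (mod int p)" if "z \<in> Z" "z \<noteq> \<one>" for z
      using F[OF that] by blast
  qed
qed

lemma derived_exponent: "z \<in> D \<Longrightarrow> z [^] p = \<one>"
  using exponent derived_subset_center center_closed by blast

lemma vectorspace_derived: "vectorspace (residue_ring (int p)) (power_module G D)"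
proof (rule vectorspace_power_module[OF prime_p derived_subgroup])
  fix g h assume "g \<in> D" "h \<in> D"
  then show "g \<otimes> h = h \<otimes> g" using derived_subset_center center_closed center_comm by blast
qed (rule derived_exponent)

text \<open>Generating the derived subgroup as a group implies spanning it: an inverse is the scalar multiple by
\<open>p - 1\<close>.\<close>

lemma dim_derived_le:
  assumes A: "finite A" "A \<subseteq> D" "generate G A = D"
  shows "vectorspace.dim (residue_ring (int p)) (power_module G D) \<le> card A"
proof -
  let ?K = "residue_ring (int p)" and ?M = "power_module G D"
  interpret V: vectorspace ?K ?M by (rule vectorspace_derived)
  have AM: "A \<subseteq> carrier ?M" using A(2) by (simp add: power_module_def)
  interpret S: submodule ?K "V.span A" ?M by (rule V.span_is_submodule[OF AM])
  have AS: "A \<subseteq> V.span A" by (rule V.in_own_span[OF AM])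
  have p1: "int p - 1 \<in> carrier ?K" using prime_gt_0_nat[OF prime_p] by (simp add: residue_ring_def)
  have "D \<subseteq> V.span A"
  proof
    fix g assume "g \<in> D"
    then have "g \<in> generate G A" using A(3) by simp
    then show "g \<in> V.span A"
    proof (induction rule: generate.induct)
      case one
      then show ?case using S.zero_closed by (simp add: power_module_def)
    next
      case (incl h)
      then show ?case using AS by blast
    next
      case (inv h)
      then have h: "h \<in> D" "h \<in> carrier G" using A(2) derived_subset_center center_closed by blast+
      have "h [^] (int p - 1) = inv h"
        using h derived_exponent[OF h(1)] by (simp add: int_pow_diff int_pow_int)
      moreover have "h [^] (int p - 1) \<in> V.span A"
        using S.smult_closed[OF p1, of h] inv AS by (auto simp: power_module_def)
      ultimately show ?case by simp
    next
      case (eng g h)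
      then show ?case using S.m_closed[of g h] by (simp add: power_module_def)
    qed
  qed
  then have "V.span A = carrier ?M"
    using S.subset by (auto simp: power_module_def)
  then show ?thesis by (rule V.gen_ge_dim[OF A(1) AM])
qed

theorem capable_if_derived_large:
  assumes nontrivial: "D \<noteq> {\<one>}"
    and dim: "n choose 2 \<le> vectorspace.dim (residue_ring (int p)) (power_module G D) + 2"
  shows "capable G"
proof -
  have fP: "finite P" by simp
  have exp: "basic_commutator q [^]\<^bsub>L\<^esub> p = \<one>" if "q \<in> P" for q
    using baer_exponent basic_commutator_closed that by blast
  have large: "card P \<le> card Q + 2" if Q: "Q \<subseteq> P" "generate L (basic_commutator ` Q) = generate L (basic_commutator ` P)" for Q
  proof -
    have fQ: "finite Q" using Q(1) fP by (rule finite_subset)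
    have "generate G (basic_commutator ` Q) = D" using Q baer_generate_basic_commutators[of Q] baer_generate_basic_commutators[of P] generate_basic_commutators by simp
    then have "vectorspace.dim (residue_ring (int p)) (power_module G D) \<le> card (basic_commutator ` Q)"
      by (intro dim_derived_le) (use fQ Q(1) basic_commutator_derived in auto)
    also have "\<dots> \<le> card Q" using fQ by (rule card_image_le)
    finally show ?thesis using dim by (simp add: card_index_pairs)
  qed
  show ?thesis
    by (rule baer.relations_spanned_by_two[OF fP basic_commutator_closed prime_p exp large])
      (assumption | rule capable_if_relations_spanned_by_two nontrivial)+
qed

end

lemma (in group) class_two_presentationI:
  assumes "prime p" and "odd p" and "nilpotent_of_class G 2" and "has_exponent G p"
    and gen: "minimally_generated_by G n x"
  shows "class_two_presentation G p n x"
proof -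
  have lc: "lower_central G 2 = {\<one>}" using \<open>nilpotent_of_class G 2\<close> by (simp add: nilpotent_of_class_def)
  have central: "commutator G g h \<in> group_center G" if gh: "g \<in> carrier G" "h \<in> carrier G" for g h
  proof -
    have c: "commutator G g h \<in> carrier G" using gh by (simp add: commutator_def)
    have 1: "commutator G g h \<in> lower_central G (Suc 0)"
      unfolding lower_central.simps commutator_def using gh by (intro generate.incl) auto
    have "commutator G g h \<otimes> k = k \<otimes> commutator G g h" if k: "k \<in> carrier G" for k
    proof -
      let ?d = "commutator G g h \<otimes> k \<otimes> inv (commutator G g h) \<otimes> inv k"
      have "?d \<in> lower_central G (Suc (Suc 0))"
        unfolding lower_central.simps(2)[of G "Suc 0"] using 1 k by (intro generate.incl) blast
      then have "?d = \<one>" using lc by (simp add: numeral_2_eq_2)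
      then have "k \<otimes> commutator G g h = ?d \<otimes> (k \<otimes> commutator G g h)" using c k by simp
      also have "\<dots> = commutator G g h \<otimes> (k \<otimes> (inv (commutator G g h) \<otimes> (inv k \<otimes> (k \<otimes> commutator G g h))))"
        using c k by (simp only: m_assoc inv_closed m_closed)
      also have "inv k \<otimes> (k \<otimes> commutator G g h) = commutator G g h"
        using c k by (simp add: m_assoc[symmetric])
      finally show ?thesis using c k by simp
    qed
    then show ?thesis using c by (simp add: group_center_def)
  qed
  have irr: "generate G (x ` ({1..n} - {i})) \<noteq> carrier G" if i: "i \<in> {1..n}" for i
  proof
    assume g: "generate G (x ` ({1..n} - {i})) = carrier G"
    have "n \<le> card (x ` ({1..n} - {i}))"
      using gen g unfolding minimally_generated_by_def by (elim conjE allE impE) auto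
    also have "\<dots> \<le> card ({1..n} - {i})" by (rule card_image_le) simp
    also have "\<dots> < card {1..n}" by (rule card_Diff1_less) (use i in simp_all)
    finally show False by simp
  qed
  show ?thesis
  proof
    show "prime p" "odd p" by fact+
    show "g [^] p = \<one>" if "g \<in> carrier G" for g
      using \<open>has_exponent G p\<close> that by (simp add: has_exponent_def)
    show "x i \<in> carrier G" if "i \<in> {1..n}" for i
      using gen that unfolding minimally_generated_by_def by blast
    show "generate G (x ` {1..n}) = carrier G"
      using gen by (simp add: minimally_generated_by_def)
  qed (rule central irr; assumption)+
qed

theorem corollary5p8:
  fixes G :: "('a, 'm) monoid_scheme" and p n :: nat and x :: "nat \<Rightarrow> 'a"
  assumes "prime p" and "odd p"
    and "group G" and "finite (carrier G)" and "\<not> comm_group G"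
    and "nilpotent_of_class G 2" and "has_exponent G p"
    and "minimally_generated_by G n x" and "n > 2"
    and "vectorspace.dim (residue_ring (int p)) (power_module G (derived G (carrier G)))
           \<ge> (n choose 2) - 2"
  shows "capable G"
proof -
  interpret class_two_presentation G p n x
    by (rule group.class_two_presentationI) (use assms in auto)
  have "derived G (carrier G) \<noteq> {\<one>\<^bsub>G\<^esub>}"
  proof
    assume triv: "derived G (carrier G) = {\<one>\<^bsub>G\<^esub>}"
    have "comm_group G"
    proof (rule group_comm_groupI)
      fix g h assume gh: "g \<in> carrier G" "h \<in> carrier G"
      then have "commutator G g h = \<one>\<^bsub>G\<^esub>" using commutator_in_derived triv by blast
      then show "g \<otimes>\<^bsub>G\<^esub> h = h \<otimes>\<^bsub>G\<^esub> g" using mult_swap[OF gh] gh by simp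
    qed
    with \<open>\<not> comm_group G\<close> show False by blast
  qed
  then show ?thesis using assms(10) by (intro capable_if_derived_large) auto
qed

end
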